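(* Let $n\ge 6$, let $\iota=\sqrt{-1}$, and let $P$ be the first eigenmatrix of the association scheme of the regular $n$-gon. Then the diagonal complex matrices $T=\mathrm{diag}(T_0,\dots,T_{\lfloor n/2\rfloor})$ with $(PT)^3=I$ are exactly the following. (a) $T_j=c(-1)^j e^{\pm\pi\iota j^2/n}$ for all $j$, where, writing $n=4m+r$ with $r\in\{0,1,2,3\}$, the constant $c$ satisfies $c^3n^{3/2}(-1)^m=e^{\pm\pi\iota/4}$ if $n=4m$, $=e^{\mp\pi\iota/4}$ if $n=4m+2$, $=1$ if $n=4m+1$, and $=\mp\iota$ if $n=4m+3$ (upper signs going with the upper sign in $T_j$, lower with lower). (b) Only when $n$ is even: $T_j=c\,e^{\pm\pi\iota j^2/n}$ for all $j$, where $c^3n^{3/2}=e^{\pm\pi\iota/4}$ (signs corresponding).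
   Context: The regular $n$-gon scheme has point set $\mathbb{Z}/n\mathbb{Z}$ with $(u,v)\in R_j$ iff $u-v\equiv\pm j \pmod n$, $0\le j\le\lfloor n/2\rfloor$. It is a self-dual P-polynomial scheme whose first eigenmatrix $P$ (idempotents in the self-dual order) has $(i,j)$ entry $P_j(i)=1$ if $j=0$, $P_j(i)=2\cos(2\pi ij/n)$ if $0<j<n/2$, and $P_j(i)=(-1)^i$ if $j=n/2$. For diagonal $T$, $PT$ has $(i,j)$ entry $P_j(i)T_j$.
   Formalization: The printed phases of c^3 n^{3/2} are wrong (n=6 in (b) gives (PT)^3 = iI); the formal theorem uses the opposite signs: in (a) e^{∓πι/4} for n=4m, e^{±πι/4} for n=4m+2, ±ι for n=4m+3, and in (b) e^{∓πι/4}; n=4m+1 is unchanged. *)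

theory Defs
  imports "Jordan_Normal_Form.Matrix" "HOL-Number_Theory.Cong"
begin

section \<open>The regular n-gon scheme and its first eigenmatrix\<close>

text \<open>The point set is represented by the residues below \<open>n\<close>; the classes are
  \<open>j \<le> n div 2\<close>.\<close>

definition ngon_rel :: "nat \<Rightarrow> nat \<Rightarrow> (nat \<times> nat) set" where
  "ngon_rel n j = {(u, v). u < n \<and> v < n \<and>
     ([int u - int v = int j] (mod int n) \<or> [int u - int v = - int j] (mod int n))}"

definition ngon_adj :: "nat \<Rightarrow> nat \<Rightarrow> complex mat" where
  "ngon_adj n j = mat n n (\<lambda>(u, v). if (u, v) \<in> ngon_rel n j then 1 else 0)"

text \<open>The idempotent number \<open>i\<close> projects onto the span of the characters
  \<open>u \<mapsto> exp (\<plusminus> 2 \<pi> \<i> i u / n)\<close>, of dimension \<open>ngon_mult n i\<close>.\<close>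

definition ngon_mult :: "nat \<Rightarrow> nat \<Rightarrow> real" where
  "ngon_mult n i = (if i = 0 \<or> 2 * i = n then 1 else 2)"

definition ngon_idem :: "nat \<Rightarrow> nat \<Rightarrow> complex mat" where
  "ngon_idem n i = mat n n (\<lambda>(u, v).
     complex_of_real (ngon_mult n i / n * cos (2 * pi * i * (real u - real v) / n)))"

definition ngon_eigenmatrix :: "nat \<Rightarrow> complex mat" where
  "ngon_eigenmatrix n = mat (n div 2 + 1) (n div 2 + 1) (\<lambda>(i, j).
     if j = 0 then 1
     else if 2 * j < n then complex_of_real (2 * cos (2 * pi * i * j / n))
     else (-1) ^ i)"


section \<open>\<open>ngon_eigenmatrix\<close> is the first eigenmatrix\<close>

text \<open>The matrices \<open>ngon_idem n i\<close> are orthogonal idempotents with sum \<open>1\<close>, and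
  \<open>ngon_adj n j\<close> acts on the image of \<open>ngon_idem n i\<close> as the scalar
  \<open>ngon_eigenmatrix n $$ (i, j)\<close>.\<close>

lemma sum_cos_residues:
  fixes k :: int and a :: real
  assumes "n > 0"
  shows "(\<Sum>v<n. cos (2 * pi * (k * real v) / n + a)) = (if int n dvd k then n * cos a else 0)"
proof -
  define z where "z = cis (2 * pi * k / n)"
  have zn: "z ^ n = 1"
    using assms by (simp add: z_def DeMoivre complex_eq_iff)
  have re: "cos (2 * pi * (k * real v) / n + a) = Re (cis a * z ^ v)" for v
    by (simp add: z_def DeMoivre cis_mult algebra_simps)
  have z1: "z = 1 \<longleftrightarrow> int n dvd k"
  proof
    assume "z = 1"
    then have "cos (2 * pi * k / n) = 1"
      by (simp add: z_def complex_eq_iff)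
    then obtain m :: int where "2 * pi * k / n = m * 2 * pi"
      by (auto simp: cos_one_2pi_int)
    then have "real_of_int k = real_of_int (int n * m)"
      using assms by (simp add: field_simps)
    then show "int n dvd k"
      by (metis dvd_triv_left of_int_eq_iff)
  next
    assume "int n dvd k"
    then obtain m where "k = int n * m" by blast
    then have "2 * pi * k / n = 2 * pi * m"
      using assms by simp
    then show "z = 1"
      unfolding z_def
      by (simp only: complex_eq_iff cis.sel cos_int_2pin sin_int_2pin) simp
  qed
  have "(\<Sum>v<n. cos (2 * pi * (k * real v) / n + a)) = Re (cis a * (\<Sum>v<n. z ^ v))"
    by (simp add: re sum_distrib_left del: Re_complex_of_real times_complex.sel)
  also have "\<dots> = (if int n dvd k then n * cos a else 0)"
  proof (cases "int n dvd k")
    case True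
    then show ?thesis using z1 by simp
  next
    case False
    then have "(\<Sum>v<n. z ^ v) = 0"
      using z1 zn by (simp add: sum_gp_strict)
    then show ?thesis using False by simp
  qed
  finally show ?thesis .
qed

lemma cos_residue_cong:
  fixes x y :: int and i :: nat
  assumes "n > 0" "[x = y] (mod int n)"
  shows "cos (2 * pi * i * x / n) = cos (2 * pi * i * y / n)"
proof -
  obtain m where "x = y + int n * m"
    using cong_sym[OF assms(2)] by (auto simp: cong_iff_lin)
  then have "2 * pi * i * x / n = 2 * pi * i * y / n + 2 * pi * real_of_int (int i * m)"
    using assms(1) by (simp add: field_simps)
  then show ?thesis
    by (simp only: cos_add cos_int_2pin sin_int_2pin)
qed

lemma dvd_small_diff:
  assumes "i \<le> n div 2" "k \<le> n div 2" "n > 0"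
  shows "int n dvd (int k - int i) \<longleftrightarrow> i = k"
proof
  assume "int n dvd int k - int i"
  moreover have "\<bar>int k - int i\<bar> < int n"
    using assms by linarith
  ultimately show "i = k"
    using dvd_imp_le_int[of "int k - int i" "int n"] by auto
qed simp

lemma dvd_small_sum:
  assumes "i \<le> n div 2" "k \<le> n div 2" "n > 0"
  shows "int n dvd (int i + int k) \<longleftrightarrow> i = k \<and> (i = 0 \<or> 2 * i = n)"
proof
  assume "int n dvd int i + int k"
  then have "n dvd i + k" by presburger
  then obtain q where q: "i + k = n * q" ..
  have "i + k \<le> n" using assms by linarith
  then have "q = 0 \<or> q = 1"
    using q assms(3) by (cases q) auto
  then show "i = k \<and> (i = 0 \<or> 2 * i = n)"
    using q assms by auto
qed auto

lemma ngon_idem_orthogonal: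
  assumes "n > 0" "i \<le> n div 2" "k \<le> n div 2"
  shows "ngon_idem n i * ngon_idem n k = (if i = k then ngon_idem n i else 0\<^sub>m n n)"
proof (rule eq_matI, goal_cases)
  case (1 u w)
  then have u: "u < n" and w: "w < n"
    by (auto simp: ngon_idem_def split: if_splits)
  let ?c = "\<lambda>i x. cos (2 * pi * real i * x / n)"
  have prod: "?c i (real u - real v) * ?c k (real v - real w) =
      (cos (2 * pi * ((int k - int i) * real v) / n + 2 * pi * (i * real u - k * real w) / n)
     + cos (2 * pi * ((int i + int k) * real v) / n + - (2 * pi * (i * real u + k * real w) / n))) / 2"
    for v
  proof -
    have 1: "2 * pi * ((int k - int i) * real v) / n + 2 * pi * (i * real u - k * real w) / n
        = 2 * pi * i * (real u - real v) / n + 2 * pi * k * (real v - real w) / n"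
      using assms(1) by (simp add: field_simps)
    have 2: "2 * pi * ((int i + int k) * real v) / n + - (2 * pi * (i * real u + k * real w) / n)
        = 2 * pi * k * (real v - real w) / n - 2 * pi * i * (real u - real v) / n"
      using assms(1) by (simp add: field_simps)
    show ?thesis unfolding 1 2 by (simp add: cos_add cos_diff)
  qed
  have s: "(\<Sum>v<n. ?c i (real u - real v) * ?c k (real v - real w)) =
      ((if i = k then n * cos (2 * pi * (i * real u - k * real w) / n) else 0)
     + (if i = k \<and> (i = 0 \<or> 2 * i = n)
        then n * cos (2 * pi * (i * real u + k * real w) / n) else 0)) / 2"
    unfolding prod sum_divide_distrib[symmetric] sum.distrib sum_cos_residues[OF assms(1)]
      dvd_small_diff[OF assms(2,3,1)] dvd_small_sum[OF assms(2,3,1)] cos_minus ..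
  have half: "cos (2 * pi * (i * real u + i * real w) / n) = cos (2 * pi * (i * real u - i * real w) / n)"
    if "i = 0 \<or> 2 * i = n"
  proof (cases "i = 0")
    case False
    with that have n: "real n = 2 * real i" by simp
    have "2 * pi * (i * real u + i * real w) / n = 2 * pi * (i * real u - i * real w) / n + 2 * pi * int w"
      unfolding n using False by (simp add: field_simps)
    then show ?thesis by (simp only: cos_add cos_int_2pin sin_int_2pin)
  qed simp
  have s': "(\<Sum>v<n. ?c i (real u - real v) * ?c k (real v - real w)) =
      (if i = k then n / ngon_mult n i * ?c i (real u - real w) else 0)"
    unfolding s using half by (auto simp: ngon_mult_def right_diff_distrib mult.assoc)
  have "(ngon_idem n i * ngon_idem n k) $$ (u, w) = complex_of_real
     (ngon_mult n i / n * (ngon_mult n k / n) * (\<Sum>v<n. ?c i (real u - real v) * ?c k (real v - real w)))"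
    using u w by (simp add: ngon_idem_def scalar_prod_def sum_distrib_left mult_ac
        flip: atLeast0LessThan)
  also have "\<dots> = (if i = k then ngon_idem n i else 0\<^sub>m n n) $$ (u, w)"
    using u w assms(1) unfolding s' by (auto simp: ngon_idem_def ngon_mult_def)
  finally show ?case .
qed (auto simp: ngon_idem_def)

lemma ngon_idem_sum:
  assumes "n > 0" "u < n" "v < n"
  shows "(\<Sum>i\<le>n div 2. ngon_idem n i $$ (u, v)) = 1\<^sub>m n $$ (u, v)"
proof -
  define f where "f = (\<lambda>i::nat. cos (2 * pi * real i * (real u - real v) / n))"
  have sym: "f (n - i) = f i" if "i \<le> n" for i
  proof -
    have "2 * pi * real (n - i) * (real u - real v) / n
        = - (2 * pi * real i * (real u - real v) / n) + 2 * pi * (int u - int v)"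
      using assms(1) that by (simp add: of_nat_diff field_simps)
    then show ?thesis
      unfolding f_def by (simp only: cos_add cos_int_2pin sin_int_2pin cos_minus)
  qed
  let ?I = "{i. 0 < i \<and> 2 * i < n}"
  have fin: "finite ?I" by (rule finite_subset[of _ "{..n}"]) auto
  have "(\<Sum>i\<in>{n div 2<..<n}. f i) = (\<Sum>i\<in>?I. f i)"
    by (rule sum.reindex_bij_witness[of _ "\<lambda>i. n - i" "\<lambda>i. n - i"]) (auto simp: sym)
  moreover have "{..<n} = {..n div 2} \<union> {n div 2<..<n}"
    using assms by auto
  moreover have "(\<Sum>i\<in>{..n div 2} \<union> {n div 2<..<n}. f i)
      = (\<Sum>i\<le>n div 2. f i) + (\<Sum>i\<in>{n div 2<..<n}. f i)"
    by (rule sum.union_disjoint) auto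
  ultimately have "(\<Sum>i<n. f i) = (\<Sum>i\<le>n div 2. f i) + (\<Sum>i\<in>?I. f i)"
    by simp
  also have "(\<Sum>i\<in>?I. f i) = (\<Sum>i\<le>n div 2. if i \<in> ?I then f i else 0)"
    by (subst sum.inter_restrict[symmetric]) (auto intro!: sum.cong)
  also have "(\<Sum>i\<le>n div 2. f i) + \<dots> = (\<Sum>i\<le>n div 2. ngon_mult n i * f i)"
    unfolding sum.distrib[symmetric]
    by (rule sum.cong) (auto simp: ngon_mult_def)
  finally have fold: "(\<Sum>i\<le>n div 2. ngon_mult n i * f i) = (\<Sum>i<n. f i)" ..
  have dvd: "int n dvd (int u - int v) \<longleftrightarrow> u = v"
  proof
    assume "int n dvd int u - int v"
    moreover have "\<bar>int u - int v\<bar> < int n" using assms by linarith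
    ultimately show "u = v"
      using dvd_imp_le_int[of "int u - int v" "int n"] by auto
  qed simp
  have "(\<Sum>i<n. f i) = (\<Sum>i<n. cos (2 * pi * ((int u - int v) * real i) / n + 0))"
    by (simp add: f_def mult_ac)
  also have "\<dots> = (if u = v then n else 0)"
    unfolding sum_cos_residues[OF assms(1)] dvd by simp
  finally have "(\<Sum>i\<le>n div 2. ngon_mult n i * f i) = (if u = v then n else 0)"
    using fold by simp
  then have "(\<Sum>i\<le>n div 2. ngon_mult n i / n * f i) = (if u = v then 1 else 0)"
    using assms(1) by (simp flip: sum_divide_distrib)
  moreover have "(\<Sum>i\<le>n div 2. ngon_idem n i $$ (u, v))
      = complex_of_real (\<Sum>i\<le>n div 2. ngon_mult n i / n * f i)"
    using assms by (simp add: ngon_idem_def f_def)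
  ultimately show ?thesis
    using assms by simp
qed

lemma ngon_adj_idem:
  assumes "n > 0" "i \<le> n div 2" "j \<le> n div 2"
  shows "ngon_adj n j * ngon_idem n i = ngon_eigenmatrix n $$ (i, j) \<cdot>\<^sub>m ngon_idem n i"
proof (rule eq_matI, goal_cases)
  case (1 u w)
  then have u: "u < n" and w: "w < n"
    by (auto simp: ngon_idem_def)
  define c where "c = (\<lambda>x::int. cos (2 * pi * i * x / n))"
  define p where "p = nat ((int u - int j) mod int n)"
  define q where "q = nat ((int u + int j) mod int n)"
  have p: "p < n" "[int p = int u - int j] (mod int n)"
    and q: "q < n" "[int q = int u + int j] (mod int n)"
    using assms(1) by (simp_all add: p_def q_def nat_less_iff)
  have rel: "(u, v) \<in> ngon_rel n j \<longleftrightarrow> v = p \<or> v = q" if "v < n" for v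
  proof -
    have "[int u - int v = int j] (mod int n) \<longleftrightarrow> [int v = int u - int j] (mod int n)"
      unfolding cong_iff_dvd_diff by (subst dvd_minus_iff[symmetric]) (simp add: algebra_simps)
    also have "\<dots> \<longleftrightarrow> v = p"
      using p that cong_less_modulus_unique_nat[of v p n]
        cong_trans[of "int v" "int u - int j" "int n" "int p"] cong_sym[OF p(2)]
      by (auto simp: cong_int_iff)
    finally have a: "[int u - int v = int j] (mod int n) \<longleftrightarrow> v = p" .
    have "[int u - int v = - int j] (mod int n) \<longleftrightarrow> [int v = int u + int j] (mod int n)"
      unfolding cong_iff_dvd_diff by (subst dvd_minus_iff[symmetric]) (simp add: algebra_simps)
    also have "\<dots> \<longleftrightarrow> v = q"
      using q that cong_less_modulus_unique_nat[of v q n]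
        cong_trans[of "int v" "int u + int j" "int n" "int q"] cong_sym[OF q(2)]
      by (auto simp: cong_int_iff)
    finally show ?thesis using a that u by (simp add: ngon_rel_def)
  qed
  have pq: "p = q \<longleftrightarrow> j = 0 \<or> 2 * j = n"
  proof -
    have "p = q \<longleftrightarrow> [int u - int j = int u + int j] (mod int n)"
      using assms(1) by (simp add: p_def q_def cong_def eq_nat_nat_iff)
    also have "\<dots> \<longleftrightarrow> int n dvd (int j + int j)"
      unfolding cong_iff_dvd_diff by (subst dvd_minus_iff[symmetric]) (simp add: algebra_simps)
    finally show ?thesis using dvd_small_sum[OF assms(3,3,1)] by simp
  qed
  have cp: "c (int p - int w) = c (int u - int w - int j)"
    unfolding c_def by (rule cos_residue_cong[OF assms(1)])
      (use p(2) in \<open>simp add: cong_iff_dvd_diff algebra_simps\<close>)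
  have cq: "c (int q - int w) = c (int u - int w + int j)"
    unfolding c_def by (rule cos_residue_cong[OF assms(1)])
      (use q(2) in \<open>simp add: cong_iff_dvd_diff algebra_simps\<close>)
  have arg: "2 * pi * i * real_of_int (x + int j) / n = 2 * pi * i * x / n + 2 * pi * i * j / n"
    "2 * pi * i * real_of_int (x - int j) / n = 2 * pi * i * x / n - 2 * pi * i * j / n" for x
    using assms(1) by (simp_all add: field_simps)
  have s: "c (int p - int w) + c (int q - int w) = 2 * cos (2 * pi * i * j / n) * c (int u - int w)"
    unfolding cp cq unfolding c_def arg by (simp add: cos_add cos_diff)
  have half: "c (int u - int w - int j) = (-1) ^ i * c (int u - int w)" if "2 * j = n"
  proof -
    have "2 * pi * i * j / n = pi * i"
      using that assms(1) by (auto simp: field_simps)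
    then show ?thesis
      unfolding c_def arg by (simp add: cos_diff mult.commute[of pi])
  qed
  have "(\<Sum>v<n. (if (u, v) \<in> ngon_rel n j then c (int v - int w) else 0))
      = (\<Sum>v\<in>{p, q}. c (int v - int w))"
    by (rule sum.mono_neutral_cong_right) (use p q rel in auto)
  also have "\<dots> = Re (ngon_eigenmatrix n $$ (i, j)) * c (int u - int w)"
  proof (cases "p = q")
    case False
    then have "j \<noteq> 0" "2 * j < n" using pq assms by auto
    then show ?thesis using False s assms by (simp add: ngon_eigenmatrix_def)
  next
    case True
    then consider "j = 0" | "2 * j = n" "j > 0" using pq assms(1) by auto
    then show ?thesis
    proof cases
      case 1
      then show ?thesis using True cp assms by (simp add: ngon_eigenmatrix_def)
    next
      case 2
      then have "Re ((-1) ^ i) = (-1) ^ i" by (cases "even i") auto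
      then show ?thesis using 2 True cp half assms by (simp add: ngon_eigenmatrix_def)
    qed
  qed
  finally have key: "(\<Sum>v<n. (if (u, v) \<in> ngon_rel n j then c (int v - int w) else 0))
      = Re (ngon_eigenmatrix n $$ (i, j)) * c (int u - int w)" .
  have real: "complex_of_real (Re (ngon_eigenmatrix n $$ (i, j))) = ngon_eigenmatrix n $$ (i, j)"
  proof -
    have "complex_of_real (Re ((-1) ^ i)) = (-1) ^ i" by (cases "even i") auto
    then show ?thesis using assms by (simp add: ngon_eigenmatrix_def)
  qed
  have "(ngon_adj n j * ngon_idem n i) $$ (u, w) = complex_of_real (ngon_mult n i / n *
      (\<Sum>v<n. (if (u, v) \<in> ngon_rel n j then c (int v - int w) else 0)))"
    using u w
    by (auto simp: ngon_adj_def ngon_idem_def scalar_prod_def sum_distrib_left c_def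
        atLeast0LessThan intro!: sum.cong)
  also have "\<dots> = ngon_eigenmatrix n $$ (i, j) *
      complex_of_real (ngon_mult n i / n * c (int u - int w))"
    unfolding key by (simp add: real)
  also have "\<dots> = (ngon_eigenmatrix n $$ (i, j) \<cdot>\<^sub>m ngon_idem n i) $$ (u, w)"
    using u w by (simp add: ngon_idem_def c_def)
  finally show ?case .
qed (auto simp: ngon_idem_def ngon_adj_def)


text \<open>Self-duality of this ordering: \<open>ngon_idem n i\<close> is \<open>1 / n\<close> times the combination of the
  \<open>ngon_adj n j\<close> with coefficients \<open>ngon_eigenmatrix n $$ (j, i)\<close>.\<close>

lemma ngon_self_dual:
  assumes "n > 0" "i \<le> n div 2" "j \<le> n div 2" "(u, v) \<in> ngon_rel n j"
  shows "ngon_idem n i $$ (u, v) = ngon_eigenmatrix n $$ (j, i) / of_nat n"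
proof -
  have uv: "u < n" "v < n"
    and "[int u - int v = int j] (mod int n) \<or> [int u - int v = - int j] (mod int n)"
    using assms(4) by (auto simp: ngon_rel_def)
  then have "cos (2 * pi * i * (int u - int v) / n) = cos (2 * pi * i * int j / n)"
    using cos_residue_cong[OF assms(1), of "int u - int v" "int j" i]
      cos_residue_cong[OF assms(1), of "int u - int v" "- int j" i] by auto
  then have eq: "cos (2 * pi * i * (real u - real v) / n) = cos (2 * pi * j * i / n)"
    by (simp add: mult_ac)
  have half: "cos (2 * pi * j * i / n) = (-1) ^ j" if "2 * i = n"
  proof -
    have "2 * pi * j * i / n = real j * pi"
      using that assms(1) by (auto simp: field_simps)
    then show ?thesis by simp
  qed
  show ?thesis
    using uv assms(1-3) half
    by (auto simp: ngon_idem_def ngon_mult_def ngon_eigenmatrix_def eq)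
qed


section \<open>The sign of the phase\<close>

text \<open>For even \<open>n\<close>, put \<open>P = ngon_eigenmatrix n\<close>, \<open>t j = exp (\<plusminus> \<pi> \<i> j^2 / n)\<close> and
  \<open>D = diag t\<close>. Completing the square gives \<open>P D P = G inv(D) P inv(D)\<close>, where \<open>G\<close> is the
  quadratic Gauss sum \<open>\<Sum>x<n. t x = sqrt n exp (\<plusminus> \<pi> \<i> / 4)\<close>. Hence \<open>(P (c D))^3 = c^3 n G 1\<close>,
  and the phase of \<open>c^3 n powr (3 / 2)\<close> must be the conjugate \<open>exp (\<minusplus> \<pi> \<i> / 4)\<close> of the phase
  of \<open>G\<close>. In the informal source these phases (and those for the solutions with the factor
  \<open>(-1)^j\<close>) appear with the opposite sign; that version already fails for the hexagon.\<close>

lemma hexagon_phase: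
  fixes c :: complex
  defines "T \<equiv> mat_diag 4 (\<lambda>j. c * exp (of_real pi * \<i> * of_nat j ^ 2 / 6))"
  assumes "(ngon_eigenmatrix 6 * T) ^\<^sub>m 3 = 1\<^sub>m 4"
  shows "c ^ 3 * of_real (6 powr (3 / 2)) = exp (- (of_real pi * \<i> / 4))"
    and "c ^ 3 * of_real (6 powr (3 / 2)) \<noteq> exp (of_real pi * \<i> / 4)"
proof -
  let ?P = "ngon_eigenmatrix 6"
  define t where "t = (\<lambda>j::nat. c * exp (of_real pi * \<i> * of_nat j ^ 2 / 6))"
  define A where "A = mat 4 4 (\<lambda>(i, j). ?P $$ (i, j) * t j)"
  have P: "?P \<in> carrier_mat 4 4"
    by (simp add: ngon_eigenmatrix_def)
  have A: "?P * T = A"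
    unfolding T_def A_def t_def by (rule mat_diag_mult_right[OF P])
  have Ac: "A \<in> carrier_mat 4 4"
    by (simp add: A_def)
  have "(A * A * A) $$ (0, 0) = 1"
    using assms(2) Ac unfolding A by (simp add: numeral_3_eq_3)
  moreover have "(A * A * A) $$ (0, 0) = (\<Sum>j<4. A $$ (0, j) * (\<Sum>k<4. A $$ (j, k) * A $$ (k, 0)))"
    using Ac by (simp add: scalar_prod_def atLeast0LessThan)
  ultimately have one: "(\<Sum>j<4. A $$ (0, j) * (\<Sum>k<4. A $$ (j, k) * A $$ (k, 0))) = 1"
    by simp
  have sqrt3: "complex_of_real (sqrt 3) ^ 2 = 3"
    by (simp flip: of_real_power)
  define w where "w = cis (pi / 6)"
  have w: "w = (of_real (sqrt 3) + \<i>) / 2"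
    by (simp add: w_def complex_eq_iff cos_30 sin_30)
  have t: "t 0 = c" "t 1 = c * w" "t 2 = c * w ^ 4" "t 3 = c * w ^ 9"
    by (simp_all add: t_def w_def cis_conv_exp exp_of_nat_mult[symmetric] mult_ac)
  have w4: "w ^ 4 = (\<i> * of_real (sqrt 3) - 1) / 2" and w9: "w ^ 9 = - \<i>"
  proof -
    have "4 * (pi / 6) = pi - pi / 3" "9 * (pi / 6) = 3 / 2 * pi" by simp_all
    then have "w ^ 4 = cis (pi - pi / 3)" "w ^ 9 = cis (3 / 2 * pi)"
      by (simp_all only: w_def DeMoivre of_nat_numeral)
    then show "w ^ 4 = (\<i> * of_real (sqrt 3) - 1) / 2" "w ^ 9 = - \<i>"
      by (simp_all only: complex_eq_iff cis.sel cos_diff sin_diff cos_60 sin_60 cos_pi sin_pi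
          cos_3over2_pi sin_3over2_pi) simp_all
  qed
  have c: "cos (2 * pi / 6) = 1 / 2" "cos (4 * pi / 6) = - 1 / 2" "cos (8 * pi / 6) = - 1 / 2"
    "cos (12 * pi / 6) = 1"
  proof -
    have "2 * pi / 6 = pi / 3" "4 * pi / 6 = pi - pi / 3" "8 * pi / 6 = pi + pi / 3"
      "12 * pi / 6 = 2 * pi" by simp_all
    then show "cos (2 * pi / 6) = 1 / 2" "cos (4 * pi / 6) = - 1 / 2" "cos (8 * pi / 6) = - 1 / 2"
      "cos (12 * pi / 6) = 1"
      by (simp_all only: cos_add cos_diff cos_60 cos_pi sin_pi cos_two_pi)
  qed
  have row: "?P $$ (i, 0) = 1" if "i < 4" for i
    using that by (simp add: ngon_eigenmatrix_def)
  have P0: "?P $$ (0, 1) = 2" "?P $$ (0, 2) = 2" "?P $$ (0, 3) = 1"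
    and P1: "?P $$ (1, 1) = 1" "?P $$ (1, 2) = - 1" "?P $$ (1, 3) = - 1"
    and P2: "?P $$ (2, 1) = - 1" "?P $$ (2, 2) = - 1" "?P $$ (2, 3) = 1"
    and P3: "?P $$ (3, 1) = - 2" "?P $$ (3, 2) = 2" "?P $$ (3, 3) = - 1"
    using c by (simp_all add: ngon_eigenmatrix_def mult_ac)
  have sum4: "(\<Sum>j<4. f j) = f 0 + f 1 + f 2 + f 3" for f :: "nat \<Rightarrow> complex"
    by (simp add: numeral_eq_Suc)
  have ent: "A $$ (i, j) = ?P $$ (i, j) * t j" if "i < 4" "j < 4" for i j
    using that by (simp add: A_def)
  have "c ^ 3 * (6 * of_real (sqrt 3) * (1 + \<i>))
      = (\<Sum>j<4. A $$ (0, j) * (\<Sum>k<4. A $$ (j, k) * A $$ (k, 0)))"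
  proof -
    define r where "r = complex_of_real (sqrt 3)"
    have rr: "r * r = 3" "r * (r * x) = 3 * x" for x
      using sqrt3 by (simp_all add: r_def power2_eq_square flip: mult.assoc)
    have ii: "\<i> * (\<i> * x) = - x" for x
      by (simp flip: mult.assoc)
    have w': "w = (r + \<i>) / 2" and w4': "w ^ 4 = (\<i> * r - 1) / 2"
      using w w4 by (simp_all add: r_def)
    have "(\<Sum>j<4. A $$ (0, j) * (\<Sum>k<4. A $$ (j, k) * A $$ (k, 0))) =
        c * (c * c + 2 * (c * w) * c + 2 * (c * w ^ 4) * c + c * w ^ 9 * c)
      + 2 * (c * w) * (c * c + c * w * c - c * w ^ 4 * c - c * w ^ 9 * c)
      + 2 * (c * w ^ 4) * (c * c - c * w * c - c * w ^ 4 * c + c * w ^ 9 * c)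
      + c * w ^ 9 * (c * c - 2 * (c * w) * c + 2 * (c * w ^ 4) * c - c * w ^ 9 * c)"
      unfolding sum4 by (simp add: ent row P0 P1 P2 P3 t del: One_nat_def)
    also have "\<dots> = c ^ 3 * (6 * r * (1 + \<i>))"
      unfolding w4' w9 unfolding w' by (simp add: power3_eq_cube field_simps rr ii)
    finally show ?thesis
      unfolding r_def by simp
  qed
  with one have c3: "c ^ 3 * (6 * of_real (sqrt 3) * (1 + \<i>)) = 1"
    by simp
  define e where "e = exp (of_real pi * \<i> / 4)"
  have e: "e = of_real (sqrt 2 / 2) * (1 + \<i>)"
  proof -
    have "e = cis (pi / 4)" by (simp add: e_def cis_conv_exp mult_ac)
    then show ?thesis by (simp add: complex_eq_iff cos_45 sin_45)
  qed
  have "6 powr (3 / 2) = (6 :: real) powr (1 + 1 / 2)" by simp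
  also have "\<dots> = 6 * sqrt 6" by (subst powr_add) (simp add: powr_half_sqrt)
  finally have p: "6 powr (3 / 2) = 6 * sqrt (6 :: real)" .
  have "sqrt 6 * (sqrt 2 / 2) = sqrt 3"
    using real_sqrt_mult[of 3 2] by simp
  then have "of_real (6 powr (3 / 2)) * e = 6 * of_real (sqrt 3) * (1 + \<i>)"
    unfolding p e by (metis (no_types, lifting) mult.assoc of_real_mult of_real_numeral)
  then have 1: "c ^ 3 * of_real (6 powr (3 / 2)) * e = 1"
    using c3 by (simp only: mult.assoc)
  moreover have "exp (- (of_real pi * \<i> / 4)) * e = 1"
    unfolding e_def by (simp flip: exp_add)
  moreover have "e \<noteq> 0" by (simp add: e_def)
  ultimately show "c ^ 3 * of_real (6 powr (3 / 2)) = exp (- (of_real pi * \<i> / 4))"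
    by (metis mult_right_cancel)
  have "e * e \<noteq> 1"
    unfolding e by (simp add: complex_eq_iff)
  with 1 show "c ^ 3 * of_real (6 powr (3 / 2)) \<noteq> exp (of_real pi * \<i> / 4)"
    unfolding e_def[symmetric] by auto
qed

end

theory Submission
  imports Defs
begin

text \<open>Extend the diagonal of \<open>T\<close> to an even \<open>n\<close>-periodic function \<open>\<tau>\<close>. Since \<open>P\<close> is the Fourier
  transform on even functions and \<open>P\<^sup>2 = n\<close>, the condition \<open>(P T)\<^sup>3 = 1\<close> is equivalent to
  \<open>n T P T P T = P\<close>, which for \<open>a = \<tau> 0 / \<tau>\<close> implies
  \<open>a (i + j) + a (i - j) = 2 cos (2 \<pi> i j / n) a i a j\<close>. Comparing the two expressions for \<open>a 4\<close>
  obtained from \<open>4 = 3 + 1 = 2 + 2\<close> forces \<open>(a 1)\<^sup>2 = exp (\<plusminus> 2 \<pi> \<i> / n)\<close>, and the recurrence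
  for \<open>j = 1\<close> together with periodicity leaves only \<open>\<tau> j = c (\<plusminus> 1)\<^sup>j exp (\<plusminus> \<pi> \<i> j\<^sup>2 / n)\<close>.
  For such \<open>\<tau>\<close> completing the square reduces the condition to \<open>n c\<^sup>3 G = 1\<close> with a quadratic
  Gauss sum \<open>G\<close>, whose value is found from a q-binomial sum that factors.\<close>

section \<open>Sums over a period\<close>

text \<open>Shifting by one trades the term at \<open>y\<close> for the equal term at
  \<open>y + int n\<close>; induction in both directions reaches every integer.\<close>

lemma sum_period_shift:
  fixes F :: "int \<Rightarrow> complex" and n :: nat
  assumes per: "\<And>x. F (x + int n) = F x"
  shows "(\<Sum>x<n. F (int x + y)) = (\<Sum>x<n. F (int x))"
proof -
  have step: "(\<Sum>x<n. F (int x + (y + 1))) = (\<Sum>x<n. F (int x + y))" for y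
  proof -
    have "(\<Sum>x<n. F (int x + (y + 1))) + F y = (\<Sum>x<Suc n. F (int x + y))"
      by (subst sum.lessThan_Suc_shift) (simp add: ac_simps)
    also have "\<dots> = (\<Sum>x<n. F (int x + y)) + F y"
      using per[of y] by (simp add: ac_simps)
    finally show ?thesis by simp
  qed
  show ?thesis
  proof (induction y rule: int_induct[where k = 0])
    case (step2 i)
    then show ?case using step[of "i - 1"] by simp
  qed (use step in simp_all)
qed

lemma sum_period_uminus:
  fixes F :: "int \<Rightarrow> complex" and n :: nat
  assumes per: "\<And>x. F (x + int n) = F x"
  shows "(\<Sum>x<n. F (- int x)) = (\<Sum>x<n. F (int x))"
proof -
  \<comment> \<open>Reversing the order of summation turns negation into a shift by one modulo
    \<open>n\<close>.\<close>
  have "(\<Sum>x<n. F (- int x)) = (\<Sum>x<n. F (- int (n - Suc x)))"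
    by (rule sum.nat_diff_reindex[symmetric])
  also have "\<dots> = (\<Sum>x<n. F (int x + 1))"
  proof (rule sum.cong)
    fix x assume "x \<in> {..<n}"
    then have "- int (n - Suc x) + int n = int x + 1" by auto
    then show "F (- int (n - Suc x)) = F (int x + 1)"
      using per[of "- int (n - Suc x)"] by metis
  qed simp
  also have "\<dots> = (\<Sum>x<n. F (int x))"
    by (rule sum_period_shift) (rule per)
  finally show ?thesis .
qed

text \<open>\<open>ngon_mult n j\<close> is the size of the orbit of \<open>j\<close> under negation
  of residues. This converts sums over the classes of the scheme into sums over all residues, where
  shifts are available.\<close>

lemma sum_period_fold:
  fixes F :: "int \<Rightarrow> complex" and n :: nat
  assumes per: "\<And>x. F (x + int n) = F x" and even: "\<And>x. F (- x) = F x" and "n > 0"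
  shows "(\<Sum>j\<le>n div 2. ngon_mult n j * F (int j)) = (\<Sum>x<n. F (int x))"
proof -
  have sym: "F (int (n - i)) = F (int i)" if "i \<le> n" for i
    using per[of "- int i"] even that by (simp add: of_nat_diff ac_simps)
  let ?I = "{i. 0 < i \<and> 2 * i < n}"
  have "(\<Sum>i\<in>{n div 2<..<n}. F (int i)) = (\<Sum>i\<in>?I. F (int i))"
    by (rule sum.reindex_bij_witness[of _ "\<lambda>i. n - i" "\<lambda>i. n - i"])
      (use sym in \<open>auto simp del: of_nat_diff\<close>)
  moreover have "{..<n} = {..n div 2} \<union> {n div 2<..<n}"
    using assms(3) by auto
  moreover have "(\<Sum>i\<in>{..n div 2} \<union> {n div 2<..<n}. F (int i))
      = (\<Sum>i\<le>n div 2. F (int i)) + (\<Sum>i\<in>{n div 2<..<n}. F (int i))"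
    by (rule sum.union_disjoint) auto
  ultimately have "(\<Sum>i<n. F (int i)) = (\<Sum>i\<le>n div 2. F (int i)) + (\<Sum>i\<in>?I. F (int i))"
    by simp
  also have "(\<Sum>i\<in>?I. F (int i)) = (\<Sum>i\<le>n div 2. if i \<in> ?I then F (int i) else 0)"
    by (subst sum.inter_restrict[symmetric]) (auto intro!: sum.cong)
  also have "(\<Sum>i\<le>n div 2. F (int i)) + \<dots> = (\<Sum>i\<le>n div 2. ngon_mult n i * F (int i))"
    unfolding sum.distrib[symmetric]
    by (rule sum.cong) (auto simp: ngon_mult_def)
  finally show ?thesis ..
qed

lemma sum_cis_residues:
  fixes k :: int
  assumes "n > 0"
  shows "(\<Sum>v<n. cis (2 * pi * (k * real v) / n)) = (if int n dvd k then of_nat n else 0)"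
proof -
  \<comment> \<open>A sine is a cosine with phase \<open>- (pi / 2)\<close>, so the cosine sum also
    yields the imaginary part.\<close>
  have "sin x = cos (x + - (pi / 2))" for x :: real
    by (simp add: cos_diff)
  then show ?thesis
    using sum_cos_residues[OF assms, of k 0] sum_cos_residues[OF assms, of k "- (pi / 2)"]
    by (simp add: complex_eq_iff del: minus_divide_left)
qed

section \<open>Quadratic phases\<close>

text \<open>\<open>s\<close> is the sign of the exponent. For \<open>s = \<plusminus> 1\<close>,
  \<open>d = 1\<close> inserts the factor \<open>(-1)^x\<close> and \<open>d = 0\<close> inserts
  nothing; keeping this factor in the exponent lets one computation cover both families of
  solutions.\<close>

definition quad_phase :: "nat \<Rightarrow> nat \<Rightarrow> real \<Rightarrow> int \<Rightarrow> complex" where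
  "quad_phase n d s x = cis (s * pi * (real_of_int x ^ 2 + d * n * x) / n)"

definition gauss_sum :: "nat \<Rightarrow> nat \<Rightarrow> real \<Rightarrow> complex" where
  "gauss_sum n d s = (\<Sum>x<n. quad_phase n d s (int x))"

lemma cis_sign_2pi_int:
  assumes "s \<in> {1, -1 :: real}"
  shows "cis (s * (2 * pi * real_of_int k)) = 1"
  using assms cis_multiple_2pi[of "real_of_int k"] cis_multiple_2pi[of "real_of_int (- k)"]
  by auto

lemma quad_phase_0 [simp]: "quad_phase n d s 0 = 1"
  by (simp add: quad_phase_def)

lemma quad_phase_nonzero [simp]: "quad_phase n d s x \<noteq> 0"
  by (simp add: quad_phase_def)

lemma quad_phase_add:
  assumes "n > 0"
  shows "quad_phase n d s (x + y) =
    quad_phase n d s x * quad_phase n d s y * cis (s * (2 * pi * (real_of_int x * y) / n))"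
  unfolding quad_phase_def cis_mult
  by (rule arg_cong[where f = cis]) (use assms in \<open>simp add: field_simps power2_eq_square\<close>)

lemma quad_phase_minus:
  assumes "n > 0" "s \<in> {1, -1}"
  shows "quad_phase n d s (- x) = quad_phase n d s x"
proof -
  have "s * pi * (real_of_int (- x) ^ 2 + real d * real n * real_of_int (- x)) / n
      = s * pi * (real_of_int x ^ 2 + real d * real n * x) / n + s * (2 * pi * real_of_int (- (int d * x)))"
    using assms(1) by (simp add: field_simps)
  then show ?thesis
    unfolding quad_phase_def of_nat_mult
    using cis_sign_2pi_int[OF assms(2), of "- (int d * x)"]
    by (simp only: cis_mult[symmetric] mult_1_right)
qed

text \<open>At \<open>x = n\<close> the exponent is \<open>s * pi * n * (d + 1)\<close>, whence the
  parity condition.\<close>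

lemma quad_phase_period:
  assumes "n > 0" "s \<in> {1, -1}" "even (n * (d + 1))"
  shows "quad_phase n d s (x + int n) = quad_phase n d s x"
proof -
  from assms(3) obtain k where k: "n * (d + 1) = 2 * k" ..
  have "quad_phase n d s (int n) = cis (s * (2 * pi * real_of_int (int k)))"
  proof -
    have "real n * (real d + 1) = 2 * real k"
      using arg_cong[OF k, of real] by (simp add: algebra_simps)
    moreover have "s * pi * (real_of_int (int n) ^ 2 + d * n * int n) / n = s * pi * (real n * (real d + 1))"
      using assms(1) by (simp add: field_simps power2_eq_square)
    ultimately show ?thesis
      by (simp add: quad_phase_def mult_ac)
  qed
  then have 1: "quad_phase n d s (int n) = 1"
    using cis_sign_2pi_int[OF assms(2), of "int k"] by simp
  have "s * (2 * pi * (real_of_int x * real_of_int (int n)) / n) = s * (2 * pi * real_of_int x)"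
    using assms(1) by simp
  then show ?thesis
    using quad_phase_add[OF assms(1), of d s x "int n"] 1 cis_sign_2pi_int[OF assms(2), of x]
    by (simp only: mult_1_right)
qed

lemma quad_phase_cnj: "cnj (quad_phase n d s x) = quad_phase n d (- s) x"
  by (simp add: quad_phase_def cis_cnj)

lemma gauss_sum_cnj: "cnj (gauss_sum n d s) = gauss_sum n d (- s)"
  by (simp add: gauss_sum_def quad_phase_cnj)

text \<open>Completing the square: replacing \<open>x\<close> by \<open>x + y\<close> leaves the
  Gauss sum unchanged and splits off the phase at \<open>y\<close>.\<close>

lemma quad_phase_fourier:
  assumes "n > 0" "s \<in> {1, -1}" "even (n * (d + 1))"
  shows "(\<Sum>x<n. cis (s * (2 * pi * (real x * real_of_int y) / n)) * quad_phase n d s (int x))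
    = gauss_sum n d s / quad_phase n d s y"
proof -
  have "gauss_sum n d s = (\<Sum>x<n. quad_phase n d s (int x + y))"
    unfolding gauss_sum_def
    by (rule sum_period_shift[symmetric]) (rule quad_phase_period[OF assms])
  also have "\<dots> = quad_phase n d s y *
      (\<Sum>x<n. cis (s * (2 * pi * (real x * real_of_int y) / n)) * quad_phase n d s (int x))"
    unfolding quad_phase_add[OF assms(1)] sum_distrib_left by (simp add: mult_ac)
  finally show ?thesis by simp
qed

text \<open>\<open>G * cnj G\<close> is a sum of Fourier coefficients of the phase; after exchanging
  the sums, orthogonality of characters leaves only \<open>x = 0\<close>.\<close>

lemma cmod_gauss_sum:
  assumes "n > 0" "s \<in> {1, -1}" "even (n * (d + 1))"
  shows "cmod (gauss_sum n d s) = sqrt n"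
proof -
  have "gauss_sum n d s * cnj (gauss_sum n d s)
      = (\<Sum>y<n. gauss_sum n d s / quad_phase n d s (int y))"
    unfolding gauss_sum_def[of n d s] cnj_sum sum_distrib_left
    by (intro sum.cong refl) (simp add: quad_phase_def cis_cnj divide_inverse)
  also have "\<dots> = (\<Sum>y<n. \<Sum>x<n. cis (s * (2 * pi * (real x * real y) / n)) * quad_phase n d s (int x))"
    unfolding quad_phase_fourier[OF assms, symmetric] by simp
  also have "\<dots> = (\<Sum>x<n. (\<Sum>y<n. cis (s * (2 * pi * (real x * real y) / n))) * quad_phase n d s (int x))"
    unfolding sum_distrib_right by (rule sum.swap)
  also have "\<dots> = (\<Sum>x<n. if x = 0 then of_nat n else 0)"
  proof (rule sum.cong)
    fix x assume x: "x \<in> {..<n}"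
    obtain e :: int where e: "s = real_of_int e" "e \<in> {1, -1}"
      using assms(2) by (metis insertE insertI1 insertI2 of_int_1 of_int_minus singletonD)
    have "(\<Sum>y<n. cis (s * (2 * pi * (real x * real y) / n)))
        = (\<Sum>y<n. cis (2 * pi * (real_of_int (e * int x) * real y) / n))"
      by (simp add: e mult_ac)
    also have "\<dots> = (if int n dvd e * int x then of_nat n else 0)"
      by (rule sum_cis_residues[OF assms(1)])
    also have "int n dvd e * int x \<longleftrightarrow> x = 0"
      using e(2) x nat_dvd_not_less[of x n] by (cases "x = 0") auto
    finally show "(\<Sum>y<n. cis (s * (2 * pi * (real x * real y) / n))) * quad_phase n d s (int x)
        = (if x = 0 then of_nat n else 0)"
      by simp
  qed simp
  also have "\<dots> = of_nat n"
    using assms(1) by simp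
  finally have "complex_of_real (cmod (gauss_sum n d s) ^ 2) = of_real (real n)"
    by (simp only: complex_norm_square of_real_of_nat_eq)
  then have "cmod (gauss_sum n d s) ^ 2 = real n"
    by (simp only: of_real_eq_iff)
  then show ?thesis
    by (metis norm_ge_zero real_sqrt_unique)
qed

section \<open>The quadratic Gauss sum\<close>

fun qbin :: "'a::comm_ring_1 \<Rightarrow> nat \<Rightarrow> nat \<Rightarrow> 'a" where
  "qbin q N 0 = 1"
| "qbin q 0 (Suc k) = 0"
| "qbin q (Suc N) (Suc k) = qbin q N k + q ^ Suc k * qbin q N (Suc k)"

lemma qbin_eq_0: "N < k \<Longrightarrow> qbin q N k = 0"
  by (induction q N k rule: qbin.induct) auto

text \<open>The quotient of neighbouring coefficients, cleared of denominators so that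
  \<open>q\<close> may be a root of unity. In the induction the pairs \<open>(k, l - 1)\<close> and
  \<open>(k - 1, l)\<close> both belong to the smaller upper index, and the Pascal rule combines
  them.\<close>

lemma qbin_ratio:
  "N = k + l \<Longrightarrow> (1 - q ^ Suc k) * qbin q N (Suc k) = (1 - q ^ l) * qbin q N k"
proof (induction N arbitrary: k l)
  case 0
  then show ?case by simp
next
  case (Suc N)
  show ?case
  proof (cases l)
    case 0
    then show ?thesis using Suc.prems by (simp add: qbin_eq_0)
  next
    case l: (Suc l')
    then have N: "N = k + l'" using Suc.prems by simp
    note IH1 = Suc.IH[OF N]
    show ?thesis
    proof (cases k)
      case 0
      have "(1 - q) * (1 + q * qbin q N 1) = (1 - q) + q * ((1 - q) * qbin q N 1)"
        by (simp add: algebra_simps)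
      also have "(1 - q) * qbin q N 1 = 1 - q ^ l'"
        using IH1 0 by simp
      also have "(1 - q) + q * (1 - q ^ l') = 1 - q ^ Suc l'"
        by (simp add: algebra_simps)
      finally show ?thesis using 0 l by simp
    next
      case k: (Suc k')
      have IH2: "(1 - q ^ k) * qbin q N k = (1 - q ^ l) * qbin q N k'"
        using Suc.IH[of k' l] N k l by simp
      have "(1 - q ^ Suc k) * qbin q (Suc N) (Suc k)
          = (1 - q ^ Suc k) * qbin q N k + q ^ Suc k * ((1 - q ^ Suc k) * qbin q N (Suc k))"
        by (simp add: algebra_simps)
      also have "\<dots> = (1 - q ^ k) * qbin q N k + q ^ k * ((1 - q ^ l) * qbin q N k)"
        unfolding IH1 l by (simp add: algebra_simps)
      also have "\<dots> = (1 - q ^ l) * qbin q (Suc N) k"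
        unfolding IH2 by (simp add: k algebra_simps)
      finally show ?thesis .
    qed
  qed
qed

section \<open>Rogers-Szego polynomials\<close>

definition rogers_szego :: "'a::comm_ring_1 \<Rightarrow> nat \<Rightarrow> 'a \<Rightarrow> 'a" where
  "rogers_szego q N x = (\<Sum>k\<le>N. qbin q N k * x ^ k)"

text \<open>The Pascal rule, with the factor \<open>q ^ Suc k\<close> absorbed into the argument
  \<open>q * x\<close>.\<close>

lemma rogers_szego_Suc:
  "rogers_szego q (Suc N) x = x * rogers_szego q N x + rogers_szego q N (q * x)"
proof -
  have "rogers_szego q (Suc N) x
      = 1 + (\<Sum>k\<le>N. (qbin q N k + q ^ Suc k * qbin q N (Suc k)) * x ^ Suc k)"
    unfolding rogers_szego_def by (subst sum.atMost_Suc_shift) simp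
  also have "\<dots> = x * rogers_szego q N x + (1 + (\<Sum>k\<le>N. qbin q N (Suc k) * (q * x) ^ Suc k))"
    unfolding rogers_szego_def sum_distrib_left
    by (simp add: sum.distrib[symmetric] power_mult_distrib algebra_simps)
  also have "1 + (\<Sum>k\<le>N. qbin q N (Suc k) * (q * x) ^ Suc k)
      = (\<Sum>k\<le>Suc N. qbin q N k * (q * x) ^ k)"
    by (subst sum.atMost_Suc_shift) simp
  also have "\<dots> = rogers_szego q N (q * x)"
    unfolding rogers_szego_def by (simp add: qbin_eq_0)
  finally show ?thesis .
qed

text \<open>A q-difference equation. Substituted into \<open>rogers_szego_Suc\<close>, it removes
  the argument \<open>q * x\<close> and gives a three-term recurrence at a fixed
  \<open>x\<close>.\<close>

lemma rogers_szego_scale: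
  "rogers_szego q (Suc N) (q * x) =
    rogers_szego q (Suc N) x - x * (1 - q ^ Suc N) * rogers_szego q N x"
proof (induction N arbitrary: x)
  case 0
  show ?case
    by (simp add: rogers_szego_def algebra_simps)
next
  case (Suc N)
  let ?H = "rogers_szego q"
  have "?H (Suc N) (q * x) - (1 - q ^ Suc N) * ?H N (q * x) = q ^ Suc N * ?H (Suc N) x"
    unfolding Suc rogers_szego_Suc[of q N x] by (simp add: algebra_simps)
  then have e: "?H (Suc N) (q * x) = q ^ Suc N * ?H (Suc N) x + (1 - q ^ Suc N) * ?H N (q * x)"
    by (simp add: algebra_simps)
  \<comment> \<open>The induction hypothesis enters here at \<open>q * x\<close>.\<close>
  have "?H (Suc (Suc N)) (q * x)
      = q * x * ?H (Suc N) (q * x) + (?H (Suc N) (q * x) - q * x * (1 - q ^ Suc N) * ?H N (q * x))"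
    by (simp only: rogers_szego_Suc[of q "Suc N" "q * x"] Suc)
  also have "q * x * ?H (Suc N) (q * x) = q * x * (q ^ Suc N * ?H (Suc N) x + (1 - q ^ Suc N) * ?H N (q * x))"
    by (simp only: e)
  finally show ?case
    unfolding rogers_szego_Suc[of q "Suc N" x] by (simp add: algebra_simps)
qed

text \<open>For \<open>q = p^2\<close> and \<open>x = p\<close> the factor
  \<open>1 - q^(M+1)\<close> of the three-term recurrence splits, and
  \<open>1 + p - p (1 - p^(M+1)) = 1 + p^(M+2)\<close> supplies the next factor of the
  product.\<close>

lemma rogers_szego_sqrt:
  "rogers_szego (p ^ 2) N p = (\<Prod>j=1..N. 1 + p ^ j)"
proof (induction N rule: less_induct)
  case (less N)
  let ?H = "rogers_szego (p ^ 2)"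
  consider "N = 0" | "N = 1" | M where "N = Suc (Suc M)"
    by (metis One_nat_def not0_implies_Suc)
  then show ?case
  proof cases
    case 3
    define A where "A = (\<Prod>j=1..M. 1 + p ^ j)"
    have 1: "?H M p = A" "?H (Suc M) p = A * (1 + p ^ Suc M)"
      using less[of M] less[of "Suc M"] 3 by (simp_all add: A_def)
    have "?H N p = (1 + p) * ?H (Suc M) p - p * (1 - (p ^ 2) ^ Suc M) * ?H M p"
      unfolding 3 rogers_szego_Suc[of _ "Suc M"] rogers_szego_scale by (simp add: algebra_simps)
    also have "(p ^ 2) ^ Suc M = p ^ Suc M * p ^ Suc M"
      by (simp add: power2_eq_square power_mult_distrib)
    also have "(1 + p) * ?H (Suc M) p - p * (1 - p ^ Suc M * p ^ Suc M) * ?H M p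
        = A * (1 + p ^ Suc M) * (1 + p ^ Suc (Suc M))"
      unfolding 1 by (simp add: algebra_simps)
    finally show ?thesis unfolding 3 by (simp add: A_def)
  qed (simp_all add: rogers_szego_def)
qed

text \<open>As \<open>q ^ n = 1\<close>, the numerator \<open>1 - q^(n-1-k)\<close> in
  \<open>qbin_ratio\<close> equals \<open>- q^(-(k+1)) (1 - q^(k+1))\<close>, so consecutive
  coefficients have the ratio \<open>- q^(-(k+1))\<close>. This makes the coefficients quadratic
  phases.\<close>

lemma qbin_root_of_unity:
  assumes "k < n"
  shows "qbin (cis (2 * pi / n)) (n - 1) k = (-1) ^ k * cis (- (pi * (real k ^ 2 + k) / n))"
  using assms
proof (induction k)
  case (Suc k)
  define q where "q = cis (2 * pi / n)"
  have n: "n > 0" using Suc.prems by simp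
  \<comment> \<open>\<open>q\<close> has exact order \<open>n\<close> and \<open>Suc k < n\<close>,
    so this factor can be cancelled.\<close>
  have ne: "1 - q ^ Suc k \<noteq> 0"
  proof
    assume "1 - q ^ Suc k = 0"
    then have "cos (real (Suc k) * (2 * pi / n)) = 1"
      unfolding q_def DeMoivre
      by (simp only: complex_eq_iff minus_complex.sel cis.sel one_complex.sel zero_complex.sel) simp
    then obtain m :: int where "real (Suc k) * (2 * pi / n) = m * 2 * pi"
      by (auto simp: cos_one_2pi_int)
    then have "(2 * pi) * real (Suc k) = (2 * pi) * (real n * m)"
      using n by (simp add: field_simps del: of_nat_Suc)
    then have "real_of_int (int (Suc k)) = real_of_int (int n * m)"
      by (simp del: of_nat_Suc)
    then have "int (Suc k) = int n * m"
      by (simp only: of_int_eq_iff)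
    then have "int n dvd int (Suc k)"
      by simp
    then show False
      using Suc.prems by (metis int_dvd_int_iff nat_dvd_not_less zero_less_Suc)
  qed
  have qn: "q ^ n = 1"
    using n by (simp add: q_def DeMoivre)
  have inv: "1 - q ^ (n - 1 - k) = - cis (- (2 * pi * Suc k / n)) * (1 - q ^ Suc k)"
  proof -
    have "q ^ (n - 1 - k) * q ^ Suc k = 1"
      unfolding power_add[symmetric] using qn Suc.prems by simp
    moreover have unit: "cis (- (2 * pi * Suc k / n)) * q ^ Suc k = 1"
    proof -
      have "- (2 * pi * Suc k / n) + real (Suc k) * (2 * pi / n) = 0"
        by (simp del: of_nat_Suc)
      then show ?thesis by (simp only: q_def DeMoivre cis_mult cis_zero)
    qed
    ultimately have "q ^ (n - 1 - k) = cis (- (2 * pi * Suc k / n))"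
      by (metis mult_cancel_right mult_zero_right zero_neq_one)
    then show ?thesis
      using unit by (simp add: algebra_simps)
  qed
  have "(1 - q ^ Suc k) * qbin q (n - 1) (Suc k) = (1 - q ^ (n - 1 - k)) * qbin q (n - 1) k"
    by (rule qbin_ratio) (use Suc.prems in simp)
  also have "\<dots> = (1 - q ^ Suc k) * (- cis (- (2 * pi * Suc k / n)) * qbin q (n - 1) k)"
    unfolding inv by (simp only: mult_ac)
  finally have "qbin q (n - 1) (Suc k) = - cis (- (2 * pi * Suc k / n)) * qbin q (n - 1) k"
    unfolding mult_left_cancel[OF ne] .
  also have "qbin q (n - 1) k = (-1) ^ k * cis (- (pi * (real k ^ 2 + k) / n))"
    using Suc by (simp add: q_def)
  also have "- cis (- (2 * pi * Suc k / n)) * ((-1) ^ k * cis (- (pi * (real k ^ 2 + k) / n)))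
      = (-1) ^ Suc k * cis (- (2 * pi * Suc k / n) + - (pi * (real k ^ 2 + k) / n))"
    unfolding cis_mult[symmetric] by simp
  also have "- (2 * pi * Suc k / n) + - (pi * (real k ^ 2 + k) / n)
      = - (pi * (real (Suc k) ^ 2 + Suc k) / n)"
    using n by (simp add: field_simps power2_eq_square)
  finally show ?case by (simp add: q_def)
qed simp

text \<open>With \<open>p = cis (\<pi> / n)\<close> the conjugate Gauss sum is the Rogers-Szego polynomial of degree
  \<open>n - 1\<close> for \<open>q = p^2\<close> at \<open>p\<close>. It factors as the product of the \<open>1 + p ^ j = 2 cos (\<pi> j / (2 n)) cis (\<pi> j / (2 n))\<close>
  with \<open>j < n\<close>, and these cosines are positive, so that the phase can be read off.\<close>

lemma gauss_sum_alternating: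
  assumes "n > 0" "s \<in> {1, -1}"
  shows "gauss_sum n 1 s = of_real (sqrt n) * cis (s * pi * (1 - real n) / 4)"
proof -
  define p where "p = cis (pi / n)"
  have p2: "p ^ 2 = cis (2 * pi / n)"
    by (simp add: p_def DeMoivre)
  have "gauss_sum n 1 (-1) = (\<Sum>k\<le>n - 1. qbin (p ^ 2) (n - 1) k * p ^ k)"
    unfolding gauss_sum_def
  proof (rule sum.cong)
    fix k assume "k \<in> {..n - 1}"
    then have "qbin (p ^ 2) (n - 1) k * p ^ k
        = (-1) ^ k * cis (- (pi * (real k ^ 2 + k) / n)) * cis (real k * (pi / n))"
      using qbin_root_of_unity[of k n] assms(1) unfolding p2 by (simp add: p_def DeMoivre)
    also have "(-1) ^ k = cis (real k * - pi)"
      unfolding DeMoivre[symmetric] by (simp add: complex_eq_iff)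
    also have "cis (real k * - pi) * cis (- (pi * (real k ^ 2 + k) / n)) * cis (real k * (pi / n))
        = quad_phase n 1 (-1) (int k)"
      unfolding quad_phase_def cis_mult
      by (rule arg_cong[where f = cis]) (use assms(1) in \<open>simp add: field_simps\<close>)
    finally show "quad_phase n 1 (-1) (int k) = qbin (p ^ 2) (n - 1) k * p ^ k" ..
  qed (use assms(1) in auto)
  also have "\<dots> = (\<Prod>j=1..n - 1. 1 + p ^ j)"
    by (simp only: rogers_szego_sqrt rogers_szego_def[symmetric])
  also have "\<dots> = (\<Prod>j=1..n - 1. of_real (2 * cos (pi * j / (2 * n))) * cis (pi / (2 * n)) ^ j)"
  proof (rule prod.cong)
    fix j
    have "pi / n * real j = 2 * (pi * j / (2 * n))" by simp
    then have "p ^ j = cis (2 * (pi * j / (2 * n)))"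
      unfolding p_def DeMoivre by (simp only: mult.commute)
    moreover have "cis (pi / (2 * n)) ^ j = cis (pi * j / (2 * n))"
      by (simp add: DeMoivre mult.commute)
    moreover have "1 + cis (2 * t) = of_real (2 * cos t) * cis t" for t
      by (simp add: complex_eq_iff cos_double_cos sin_double power2_eq_square)
    ultimately show "1 + p ^ j = of_real (2 * cos (pi * j / (2 * n))) * cis (pi / (2 * n)) ^ j"
      by (simp only:)
  qed simp
  also have "\<dots> = of_real (\<Prod>j=1..n - 1. 2 * cos (pi * j / (2 * n))) *
      cis (pi / (2 * n)) ^ (\<Sum>j=1..n - 1. j)"
    by (subst prod.distrib) (simp only: of_real_prod power_sum)
  also have "cis (pi / (2 * n)) ^ (\<Sum>j=1..n - 1. j) = cis (pi * (real n - 1) / 4)"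
  proof -
    have "2 * (\<Sum>j=1..m. real j) = real m * (real m + 1)" for m
      by (induction m) (simp_all add: algebra_simps)
    from this[of "n - 1"] have "real (\<Sum>j=1..n - 1. j) = (real n - 1) * real n / 2"
      using assms(1) by (simp add: of_nat_diff)
    then have "real (\<Sum>j=1..n - 1. j) * (pi / (2 * n)) = (real n - 1) * real n / 2 * (pi / (2 * n))"
      by (simp only:)
    also have "\<dots> = pi * (real n - 1) / 4"
      using assms(1) by simp
    finally have "real (\<Sum>j=1..n - 1. j) * (pi / (2 * n)) = pi * (real n - 1) / 4" .
    then show ?thesis by (simp only: DeMoivre)
  qed
  finally obtain R where
    R: "R = (\<Prod>j=1..n - 1. 2 * cos (pi * j / (2 * n)))" and
    G: "gauss_sum n 1 (-1) = of_real R * cis (pi * (real n - 1) / 4)"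
    by blast
  have "R > 0"
    unfolding R
  proof (rule prod_pos)
    fix j assume "j \<in> {1..n - 1}"
    then have "pi * j < pi * n" using assms(1) by auto
    then have "pi * j / (2 * n) < pi / 2"
      using assms(1) by (simp add: field_simps)
    moreover have "0 \<le> pi * j / (2 * n)" by simp
    ultimately show "0 < 2 * cos (pi * j / (2 * n))"
      using cos_gt_zero_pi[of "pi * j / (2 * n)"] pi_gt_zero by linarith
  qed
  \<comment> \<open>Being positive, the cosine product equals the modulus of the Gauss sum, which is
    already known.\<close>
  moreover have "cmod (gauss_sum n 1 (-1)) = sqrt n"
    by (rule cmod_gauss_sum) (use assms(1) in auto)
  ultimately have "R = sqrt n"
    unfolding G by (simp add: norm_mult)
  moreover have "pi * (real n - 1) / 4 = - 1 * pi * (1 - real n) / 4"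
    by (simp add: algebra_simps)
  ultimately have m: "gauss_sum n 1 (-1) = of_real (sqrt n) * cis (- 1 * pi * (1 - real n) / 4)"
    using G by (simp only:)
  have "gauss_sum n 1 1 = cnj (gauss_sum n 1 (-1))"
    using gauss_sum_cnj[of n 1 "-1"] by simp
  also have "\<dots> = of_real (sqrt n) * cis (1 * pi * (1 - real n) / 4)"
    unfolding m by (simp add: cis_cnj)
  finally show ?thesis
    using m assms(2) by auto
qed

text \<open>For \<open>n = 2 * h\<close>, \<open>(x + h)^2 / n = x^2 / n + x + n / 4\<close>: a
  shift by half a period turns \<open>d = 0\<close> into \<open>d = 1\<close> up to a constant
  phase.\<close>

lemma gauss_sum_even:
  assumes "n > 0" "even n" "s \<in> {1, -1}"
  shows "gauss_sum n 0 s = of_real (sqrt n) * cis (s * pi / 4)"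
proof -
  from assms(2) obtain h where h: "n = 2 * h" ..
  have per: "quad_phase n 0 s (x + int n) = quad_phase n 0 s x" for x
    by (rule quad_phase_period) (use assms in auto)
  have "quad_phase n 0 s (int x + int h) = cis (s * pi * real n / 4) * quad_phase n 1 s (int x)" for x
    unfolding quad_phase_def cis_mult
    by (rule arg_cong[where f = cis]) (use assms(1) in \<open>simp add: h field_simps power2_eq_square\<close>)
  then have "gauss_sum n 0 s = cis (s * pi * real n / 4) * gauss_sum n 1 s"
    unfolding gauss_sum_def sum_distrib_left
    using sum_period_shift[of "quad_phase n 0 s" n "int h", OF per] by simp
  also have "\<dots> = of_real (sqrt n) * (cis (s * pi * real n / 4) * cis (s * pi * (1 - real n) / 4))"
    unfolding gauss_sum_alternating[OF assms(1,3)] by (simp add: mult_ac)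
  also have "cis (s * pi * real n / 4) * cis (s * pi * (1 - real n) / 4) = cis (s * pi / 4)"
    unfolding cis_mult by (rule arg_cong[where f = cis]) (simp add: field_simps)
  finally show ?thesis .
qed

section \<open>Reduction to a functional equation on the residues\<close>

definition ngon_cos :: "nat \<Rightarrow> int \<Rightarrow> complex" where
  "ngon_cos n x = of_real (cos (2 * pi * real_of_int x / n))"

lemma ngon_cos_0 [simp]: "ngon_cos n 0 = 1"
  by (simp add: ngon_cos_def)

lemma ngon_cos_minus [simp]: "ngon_cos n (- x) = ngon_cos n x"
  by (simp add: ngon_cos_def)

lemma ngon_cos_period:
  assumes "n > 0"
  shows "ngon_cos n (x + int n * k) = ngon_cos n x" "ngon_cos n (x + k * int n) = ngon_cos n x"
  using cos_residue_cong[OF assms, of "x + int n * k" x 1]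
  by (simp_all add: ngon_cos_def cong_def mult.commute)

lemma ngon_cos_mult: "2 * (ngon_cos n x * ngon_cos n y) = ngon_cos n (x + y) + ngon_cos n (x - y)"
proof -
  let ?a = "2 * pi * real_of_int x / n" and ?b = "2 * pi * real_of_int y / n"
  have "2 * (cos ?a * cos ?b) = cos (?a + ?b) + cos (?a - ?b)"
    by (simp add: cos_add cos_diff)
  also have "?a + ?b = 2 * pi * real_of_int (x + y) / n"
    by (simp add: field_simps add_divide_distrib[symmetric])
  also have "?a - ?b = 2 * pi * real_of_int (x - y) / n"
    by (simp add: field_simps diff_divide_distrib[symmetric])
  finally have "complex_of_real (2 * (cos ?a * cos ?b)) = of_real (cos (2 * pi * real_of_int (x + y) / n)
      + cos (2 * pi * real_of_int (x - y) / n))"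
    by (rule arg_cong)
  then show ?thesis
    by (simp only: ngon_cos_def of_real_mult of_real_add of_real_numeral)
qed

lemma ngon_cos_cis:
  assumes "s \<in> {1, -1}"
  shows "2 * ngon_cos n x = cis (s * (2 * pi * real_of_int x / n)) + cis (s * (2 * pi * real_of_int (- x) / n))"
  using assms by (auto simp: ngon_cos_def complex_eq_iff)

lemma sum_ngon_cos:
  assumes "n > 0"
  shows "(\<Sum>x<n. ngon_cos n (k * int x)) = (if int n dvd k then of_nat n else 0)"
proof -
  have "(\<Sum>x<n. ngon_cos n (k * int x)) = of_real (\<Sum>x<n. cos (2 * pi * (k * real x) / n + 0))"
    by (simp add: ngon_cos_def)
  also have "\<dots> = (if int n dvd k then of_nat n else 0)"
    unfolding sum_cos_residues[OF assms] by simp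
  finally show ?thesis .
qed

lemma period_multiple:
  fixes F :: "int \<Rightarrow> complex"
  assumes per: "\<And>x. F (x + n) = F x"
  shows "F (x + n * k) = F x"
proof (induction k rule: int_induct[where k = 0])
  case (step1 i)
  then show ?case using per[of "x + n * i"] by (simp add: algebra_simps)
next
  case (step2 i)
  then show ?case using per[of "x + n * (i - 1)"] by (simp add: algebra_simps)
qed simp

text \<open>Every integer is congruent to \<open>r\<close> or \<open>- r\<close> for some
  \<open>r \<le> n div 2\<close>.\<close>

lemma even_periodic_eqI:
  fixes F G :: "int \<Rightarrow> complex" and n :: nat
  assumes "n > 0"
    and perF: "\<And>x. F (x + int n) = F x" and evF: "\<And>x. F (- x) = F x"
    and perG: "\<And>x. G (x + int n) = G x" and evG: "\<And>x. G (- x) = G x"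
    and eq: "\<And>j. j \<le> n div 2 \<Longrightarrow> F (int j) = G (int j)"
  shows "F x = G x"
proof -
  define r where "r = nat (x mod int n)"
  have r: "r < n" "x = int r + int n * (x div int n)"
    using assms(1) by (simp_all add: r_def nat_less_iff)
  have red: "F x = F (int r)" "G x = G (int r)"
    using period_multiple[of F "int n", OF perF] period_multiple[of G "int n", OF perG] r(2)
    by metis+
  show ?thesis
  proof (cases "r \<le> n div 2")
    case False
    then have "n - r \<le> n div 2" by linarith
    moreover have "int (n - r) = - int r + int n"
      using r(1) by simp
    ultimately have "F (- int r + int n) = G (- int r + int n)"
      using eq[of "n - r"] by metis
    then show ?thesis unfolding red perF perG evF evG .
  qed (simp add: red eq)
qed

text \<open>One formula for all three cases of the definition: for \<open>2 * j = n\<close> the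
  cosine is \<open>(-1) ^ i\<close> and the weight is 1.\<close>

lemma ngon_eigenmatrix_entry:
  assumes "n > 0" "i \<le> n div 2" "j \<le> n div 2"
  shows "ngon_eigenmatrix n $$ (i, j) = ngon_mult n j * ngon_cos n (int i * int j)"
proof -
  have "cos (2 * pi * (real i * real j) / n) = (-1) ^ i" if "2 * j = n"
  proof -
    have "2 * pi * (real i * real j) / n = real i * pi"
      using that assms(1) by (auto simp: field_simps)
    then show ?thesis by simp
  qed
  then show ?thesis
    using assms by (auto simp: ngon_eigenmatrix_def ngon_mult_def ngon_cos_def mult_ac)
qed

text \<open>Unfolding to all residues leaves character sums at \<open>i + k\<close> and
  \<open>k - i\<close>. Both vanish for \<open>i \<noteq> k\<close>; for \<open>i = k\<close> both
  survive exactly when \<open>ngon_mult n k\<close> is 1, which balances the weight.\<close>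

lemma ngon_eigenmatrix_square:
  assumes "n > 0"
  shows "ngon_eigenmatrix n * ngon_eigenmatrix n = of_nat n \<cdot>\<^sub>m 1\<^sub>m (n div 2 + 1)"
proof (rule eq_matI, goal_cases)
  case (1 i k)
  then have ik: "i \<le> n div 2" "k \<le> n div 2" by auto
  let ?P = "ngon_eigenmatrix n" and ?C = "ngon_cos n"
  have "(?P * ?P) $$ (i, k) = (\<Sum>j<n div 2 + 1. ?P $$ (i, j) * ?P $$ (j, k))"
    using ik by (simp add: ngon_eigenmatrix_def scalar_prod_def atLeast0LessThan)
  also have "\<dots> = (\<Sum>j\<le>n div 2. ngon_mult n j * (?C (int i * int j) * ?C (int j * int k) * ngon_mult n k))"
    using ik by (intro sum.cong) (auto simp: ngon_eigenmatrix_entry[OF assms])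
  also have "\<dots> = (\<Sum>x<n. ?C (int i * int x) * ?C (int x * int k) * ngon_mult n k)"
    by (rule sum_period_fold[of "\<lambda>x. ?C (int i * x) * ?C (x * int k) * ngon_mult n k" n, OF _ _ assms])
      (simp_all add: ngon_cos_period[OF assms] distrib_left distrib_right)
  also have "\<dots> = (\<Sum>x<n. ?C ((int i + int k) * int x) + ?C ((int k - int i) * int x)) * ngon_mult n k / 2"
  proof -
    have *: "?C (int i * x) * ?C (x * int k) = (?C ((int i + int k) * x) + ?C ((int k - int i) * x)) / 2" for x
      using ngon_cos_mult[of n "x * int k" "int i * x"] by (simp add: algebra_simps)
    show ?thesis
      by (simp add: * sum_distrib_right sum_divide_distrib)
  qed
  also have "\<dots> = (of_nat n \<cdot>\<^sub>m 1\<^sub>m (n div 2 + 1)) $$ (i, k)"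
    unfolding sum.distrib sum_ngon_cos[OF assms] dvd_small_diff[OF ik assms] dvd_small_sum[OF ik assms]
    using ik by (auto simp: ngon_mult_def)
  finally show ?case .
qed (auto simp: ngon_eigenmatrix_def)

lemma ngon_cube_iff_entries:
  assumes "n > 0" and T: "T \<in> carrier_mat (n div 2 + 1) (n div 2 + 1)" and "diagonal_mat T"
  shows "(ngon_eigenmatrix n * T) ^\<^sub>m 3 = 1\<^sub>m (n div 2 + 1) \<longleftrightarrow>
    (\<forall>i\<le>n div 2. \<forall>j\<le>n div 2. of_nat n * T $$ (i, i) * T $$ (j, j) *
      (\<Sum>k\<le>n div 2. ngon_mult n k * (ngon_cos n (int i * int k) * ngon_cos n (int k * int j) * T $$ (k, k)))
      = ngon_cos n (int i * int j))"
proof -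
  define d where "d = n div 2 + 1"
  define P where "P = ngon_eigenmatrix n"
  define t where "t = (\<lambda>j. T $$ (j, j))"
  have P: "P \<in> carrier_mat d d"
    by (simp add: P_def d_def ngon_eigenmatrix_def)
  have Td: "T = mat_diag d t"
    using T assms(3) by (intro eq_matI) (auto simp: mat_diag_def t_def diagonal_mat_def d_def)
  have T: "T \<in> carrier_mat d d"
    using T by (simp add: d_def)
  have PP: "P * P = of_nat n \<cdot>\<^sub>m 1\<^sub>m d"
    unfolding P_def d_def by (rule ngon_eigenmatrix_square[OF assms(1)])
  define A3 where "A3 = (P * T) ^\<^sub>m 3"
  define Q where "Q = T * (P * (T * P)) * T"
  have A3: "A3 \<in> carrier_mat d d" and Q: "Q \<in> carrier_mat d d"
    using P T by (auto simp: A3_def Q_def)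
  have A3_eq: "A3 = P * Q"
    using P T
    by (simp add: A3_def Q_def numeral_3_eq_3 assoc_mult_mat[of _ d d _ d _ d])
  \<comment> \<open>Multiplication by \<open>P\<close> is invertible because \<open>P * P\<close> is
    \<open>n\<close> times the identity.\<close>
  have "A3 = 1\<^sub>m d \<longleftrightarrow> of_nat n \<cdot>\<^sub>m Q = P"
  proof
    assume "A3 = 1\<^sub>m d"
    then have "P * (P * Q) = P"
      using P by (simp add: A3_eq)
    moreover have "P * (P * Q) = of_nat n \<cdot>\<^sub>m Q"
      using Q by (simp add: assoc_mult_mat[OF P P Q, symmetric] PP mult_smult_assoc_mat[of _ d d _ d])
    ultimately show "of_nat n \<cdot>\<^sub>m Q = P" by simp
  next
    assume "of_nat n \<cdot>\<^sub>m Q = P"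
    then have "P * (of_nat n \<cdot>\<^sub>m Q) = of_nat n \<cdot>\<^sub>m 1\<^sub>m d"
      by (simp add: PP)
    then have eq: "of_nat n \<cdot>\<^sub>m A3 = of_nat n \<cdot>\<^sub>m 1\<^sub>m d"
      using P Q by (simp add: A3_eq mult_smult_distrib[of P d d Q d])
    show "A3 = 1\<^sub>m d"
    proof (rule eq_matI)
      fix i j assume ij: "i < dim_row (1\<^sub>m d)" "j < dim_col (1\<^sub>m d)"
      from arg_cong[OF eq, of "\<lambda>M. M $$ (i, j)"] show "A3 $$ (i, j) = 1\<^sub>m d $$ (i, j)"
        using ij A3 assms(1) by (simp split: if_splits)
    qed (use A3 in auto)
  qed
  also have "of_nat n \<cdot>\<^sub>m Q = P \<longleftrightarrow> (\<forall>i<d. \<forall>j<d. of_nat n * Q $$ (i, j) = P $$ (i, j))"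
    using P Q by (auto simp: mat_eq_iff)
  also have "\<dots> \<longleftrightarrow> (\<forall>i<d. \<forall>j<d. of_nat n * t i * t j *
      (\<Sum>k\<le>n div 2. ngon_mult n k * (ngon_cos n (int i * int k) * ngon_cos n (int k * int j) * t k))
      = ngon_cos n (int i * int j))"
  proof (intro all_cong)
    fix i j assume ij: "i < d" "j < d"
    then have ij': "i \<le> n div 2" "j \<le> n div 2" by (auto simp: d_def)
    \<comment> \<open>The weight of column \<open>j\<close> occurs on both sides; cancelling it
      leaves an equation symmetric in \<open>i\<close> and \<open>j\<close>.\<close>
    define w where "w = complex_of_real (ngon_mult n j)"
    have w: "w \<noteq> 0" by (simp add: w_def ngon_mult_def)
    define S where "S = (\<Sum>k\<le>n div 2. ngon_mult n k *
      (ngon_cos n (int i * int k) * ngon_cos n (int k * int j) * t k))"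
    have "Q = mat d d (\<lambda>(i, j). t i * (P * (T * P)) $$ (i, j) * t j)"
      unfolding Q_def using P T
      by (subst (1 3) Td) (auto simp: mat_diag_mult_left[of _ d d] mat_diag_mult_right[of _ d d])
    then have "Q $$ (i, j) = t i * (P * (T * P)) $$ (i, j) * t j"
      using ij by simp
    also have "T * P = mat d d (\<lambda>(i, j). t i * P $$ (i, j))"
      using P by (subst Td) (rule mat_diag_mult_left)
    also have "(P * \<dots>) $$ (i, j) = (\<Sum>k<d. P $$ (i, k) * (t k * P $$ (k, j)))"
      using P ij by (simp add: scalar_prod_def atLeast0LessThan)
    also have "\<dots> = w * S"
      unfolding S_def sum_distrib_left
      by (rule sum.cong) (use ij' in \<open>auto simp: d_def P_def w_def ngon_eigenmatrix_entry[OF assms(1)]\<close>)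
    finally have "Q $$ (i, j) = w * (t i * t j * S)" by (simp add: mult_ac)
    moreover have "P $$ (i, j) = w * ngon_cos n (int i * int j)"
      unfolding P_def w_def by (rule ngon_eigenmatrix_entry[OF assms(1) ij'])
    ultimately have "of_nat n * Q $$ (i, j) = P $$ (i, j) \<longleftrightarrow>
        w * (of_nat n * t i * t j * S) = w * ngon_cos n (int i * int j)"
      by (simp only: mult_ac)
    then show "of_nat n * Q $$ (i, j) = P $$ (i, j) \<longleftrightarrow>
        of_nat n * t i * t j * S = ngon_cos n (int i * int j)"
      using w by simp
  qed
  finally show ?thesis
    by (simp add: A3_def P_def d_def t_def less_Suc_eq_le)
qed

text \<open>The entries of \<open>n T P T P T = P\<close>, with indices ranging over all integers so
  that \<open>i + j\<close> and \<open>i - j\<close> are again indices.\<close>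

definition cube_equation :: "nat \<Rightarrow> (int \<Rightarrow> complex) \<Rightarrow> bool" where
  "cube_equation n \<tau> \<longleftrightarrow> (\<forall>i j. of_nat n * \<tau> i * \<tau> j *
     (\<Sum>x<n. ngon_cos n (i * int x) * ngon_cos n (int x * j) * \<tau> (int x)) = ngon_cos n (i * j))"

text \<open>Both sides are even and \<open>n\<close>-periodic in each index, so the indices up to
  \<open>n div 2\<close> decide the equation.\<close>

lemma ngon_cube_iff_equation:
  assumes "n > 0" "T \<in> carrier_mat (n div 2 + 1) (n div 2 + 1)" "diagonal_mat T"
    and per: "\<And>x. \<tau> (x + int n) = \<tau> x" and even: "\<And>x. \<tau> (- x) = \<tau> x"
    and T: "\<And>j. j \<le> n div 2 \<Longrightarrow> T $$ (j, j) = \<tau> (int j)"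
  shows "(ngon_eigenmatrix n * T) ^\<^sub>m 3 = 1\<^sub>m (n div 2 + 1) \<longleftrightarrow> cube_equation n \<tau>"
proof -
  let ?C = "ngon_cos n"
  note C_add = ngon_cos_period[OF assms(1)]
  define L where "L = (\<lambda>i j. of_nat n * \<tau> i * \<tau> j *
     (\<Sum>x<n. ?C (i * int x) * ?C (int x * j) * \<tau> (int x)))"
  have fold: "(\<Sum>k\<le>n div 2. ngon_mult n k * (?C (i * int k) * ?C (int k * j) * T $$ (k, k)))
      = (\<Sum>x<n. ?C (i * int x) * ?C (int x * j) * \<tau> (int x))" for i j
  proof -
    have "(\<Sum>k\<le>n div 2. ngon_mult n k * (?C (i * int k) * ?C (int k * j) * T $$ (k, k)))
        = (\<Sum>k\<le>n div 2. ngon_mult n k * (?C (i * int k) * ?C (int k * j) * \<tau> (int k)))"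
      by (rule sum.cong) (simp_all add: T)
    also have "\<dots> = (\<Sum>x<n. ?C (i * int x) * ?C (int x * j) * \<tau> (int x))"
      by (rule sum_period_fold[of "\<lambda>x. ?C (i * x) * ?C (x * j) * \<tau> x" n, OF _ _ assms(1)])
        (simp_all add: C_add distrib_left distrib_right per even)
    finally show ?thesis .
  qed
  have L: "L (i + int n) j = L i j" "L (- i) j = L i j" "L i (j + int n) = L i j" "L i (- j) = L i j"
    for i j
    unfolding L_def by (simp_all add: per even distrib_left distrib_right C_add)
  have "(\<forall>i\<le>n div 2. \<forall>j\<le>n div 2. L (int i) (int j) = ?C (int i * int j)) \<longleftrightarrow>
      (\<forall>i j. L i j = ?C (i * j))" (is "?l \<longleftrightarrow> ?r")
  proof
    assume l: ?l
    have 1: "L (int i) j = ?C (int i * j)" if "i \<le> n div 2" for i j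
      by (rule even_periodic_eqI[OF assms(1), of "L (int i)" "\<lambda>j. ?C (int i * j)"])
        (use l that in \<open>auto simp: L distrib_left C_add\<close>)
    have "L i j = ?C (i * j)" for i j
      by (rule even_periodic_eqI[OF assms(1), of "\<lambda>i. L i j" "\<lambda>i. ?C (i * j)"])
        (use 1 in \<open>auto simp: L distrib_right C_add\<close>)
    then show ?r by blast
  qed blast
  then show ?thesis
    unfolding ngon_cube_iff_entries[OF assms(1-3)] fold cube_equation_def L_def[symmetric]
    by (simp add: T L_def)
qed

section \<open>Solving the functional equation\<close>

text \<open>Put \<open>B = a 1 ^ 2\<close> and \<open>C = cos (2 * pi / n)\<close>. Both expressions
  for \<open>a 4\<close> are polynomials of degree at most 2 in \<open>B\<close>, and their
  difference is a multiple of \<open>B^2 - 2 C B + 1\<close>, whose roots are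
  \<open>cis (\<plusminus> 2 * pi / n)\<close>.\<close>

lemma cos_functional_equation_at_1:
  fixes a :: "int \<Rightarrow> complex" and n :: nat
  assumes "n \<ge> 5" and a0: "a 0 = 1"
    and eq: "\<And>i j. a (i + j) + a (i - j) = 2 * ngon_cos n (i * j) * a i * a j"
  shows "\<exists>s\<in>{1, -1}. a 1 ^ 2 = cis (s * (2 * pi / n))"
proof -
  define \<theta> where "\<theta> = 2 * pi / real n"
  define C where "C = complex_of_real (cos \<theta>)"
  define B where "B = a 1 ^ 2"
  have C1: "ngon_cos n 1 = C"
    by (simp add: ngon_cos_def \<theta>_def C_def)
  have C2: "ngon_cos n 2 = 2 * C ^ 2 - 1"
    using ngon_cos_mult[of n 1 1] C1 by (simp add: power2_eq_square)
  have C3: "ngon_cos n 3 = 4 * C ^ 3 - 3 * C"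
    using ngon_cos_mult[of n 2 1] C1 C2 by (simp add: power2_eq_square power3_eq_cube algebra_simps)
  have C4: "ngon_cos n 4 = 8 * C ^ 4 - 8 * C ^ 2 + 1"
    using ngon_cos_mult[of n 2 2] C2 by (simp add: power2_eq_square power4_eq_xxxx algebra_simps)
  have a2: "a 2 = 2 * C * B - 1"
    using eq[of 1 1] a0 C1 by (simp add: B_def power2_eq_square algebra_simps)
  have a3: "a 3 = a 1 * (2 * (2 * C ^ 2 - 1) * a 2 - 1)"
    using eq[of 2 1] C2 by (simp add: algebra_simps)
  have "a 4 = 2 * (4 * C ^ 3 - 3 * C) * a 3 * a 1 - a 2"
    using eq[of 3 1] C3 by (simp add: algebra_simps)
  also have "\<dots> = 2 * (4 * C ^ 3 - 3 * C) * B * (2 * (2 * C ^ 2 - 1) * a 2 - 1) - a 2"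
    unfolding a3 B_def by (simp add: power2_eq_square algebra_simps)
  finally have "a 4 = 2 * (4 * C ^ 3 - 3 * C) * B * (2 * (2 * C ^ 2 - 1) * a 2 - 1) - a 2" .
  moreover have "a 4 = 2 * (8 * C ^ 4 - 8 * C ^ 2 + 1) * a 2 ^ 2 - 1"
    using eq[of 2 2] C4 a0 by (simp add: power2_eq_square algebra_simps)
  moreover have "2 * (4 * C ^ 3 - 3 * C) * B * (2 * (2 * C ^ 2 - 1) * (2 * C * B - 1) - 1) - (2 * C * B - 1)
      - (2 * (8 * C ^ 4 - 8 * C ^ 2 + 1) * (2 * C * B - 1) ^ 2 - 1)
      = 16 * C ^ 2 * (1 - C ^ 2) * (B ^ 2 - 2 * C * B + 1)"
    by (simp add: power2_eq_square power3_eq_cube power4_eq_xxxx algebra_simps)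
  ultimately have "16 * C ^ 2 * (1 - C ^ 2) * (B ^ 2 - 2 * C * B + 1) = 0"
    unfolding a2 by (metis diff_self)
  \<comment> \<open>\<open>n \<ge> 5\<close> puts the angle strictly between 0 and
    \<open>pi / 2\<close>.\<close>
  moreover have "C \<noteq> 0" "C ^ 2 \<noteq> 1"
  proof -
    have th: "0 < \<theta>" "\<theta> < pi / 2"
      using assms(1) pi_gt_zero by (auto simp: \<theta>_def field_simps)
    then have "cos \<theta> > 0" by (intro cos_gt_zero_pi) auto
    then show "C \<noteq> 0" by (simp add: C_def)
    have "cos \<theta> < 1"
      using th cos_monotone_0_pi[of 0 \<theta>] by simp
    with \<open>cos \<theta> > 0\<close> have "cos \<theta> ^ 2 \<noteq> 1"
      by (simp add: power2_eq_1_iff)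
    then show "C ^ 2 \<noteq> 1"
      unfolding C_def of_real_power[symmetric] by (metis of_real_eq_1_iff)
  qed
  ultimately have "B ^ 2 - 2 * C * B + 1 = 0"
    by simp
  moreover have "(B - cis \<theta>) * (B - cis (- \<theta>)) = B ^ 2 - (cis \<theta> + cis (- \<theta>)) * B + cis \<theta> * cis (- \<theta>)"
    by (simp add: power2_eq_square algebra_simps)
  moreover have "cis \<theta> + cis (- \<theta>) = 2 * C"
    by (simp add: complex_eq_iff C_def)
  moreover have "cis \<theta> * cis (- \<theta>) = 1"
    by (simp add: cis_mult)
  ultimately have "(B - cis \<theta>) * (B - cis (- \<theta>)) = 0"
    by simp
  then show ?thesis
    by (auto simp: B_def \<theta>_def)
qed

text \<open>The cross terms for \<open>y\<close> and \<open>- y\<close> are conjugate and add up to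
  twice a cosine.\<close>

lemma quad_phase_functional_equation:
  assumes "n > 0" "s \<in> {1, -1}"
  shows "quad_phase n d s (x + y) + quad_phase n d s (x - y) =
    2 * ngon_cos n (x * y) * quad_phase n d s x * quad_phase n d s y"
  using quad_phase_add[OF assms(1), of d s x y] quad_phase_add[OF assms(1), of d s x "- y"]
  unfolding ngon_cos_cis[OF assms(2)] quad_phase_minus[OF assms]
  by (simp add: algebra_simps)

lemma cos_functional_equation:
  fixes a :: "int \<Rightarrow> complex" and n :: nat
  assumes n5: "n \<ge> 5" and a0: "a 0 = 1" and an: "a (int n) = 1"
    and eq: "\<And>i j. a (i + j) + a (i - j) = 2 * ngon_cos n (i * j) * a i * a j"
  obtains s d where "s \<in> {1, -1}" "d \<in> {0, 1}" "even (n * (d + 1))"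
    "\<And>j. a (int j) = quad_phase n d s (int j)"
proof -
  have n: "n > 0" using n5 by simp
  obtain s where s: "s \<in> {1, -1}" and "a 1 ^ 2 = cis (s * (2 * pi / n))"
    using cos_functional_equation_at_1[OF n5 a0 eq] by blast
  moreover have "cis (s * (2 * pi / n)) = cis (s * pi / n) ^ 2"
    by (simp add: DeMoivre mult_ac)
  ultimately have "a 1 = cis (s * pi / n) \<or> a 1 = - cis (s * pi / n)"
    by (simp add: power2_eq_iff)
  moreover have "quad_phase n 0 s 1 = cis (s * pi / n)"
    by (simp add: quad_phase_def)
  moreover have "quad_phase n 1 s 1 = - cis (s * pi / n)"
  proof -
    have "s * pi * (1 + real n) / n = s * pi / n + s * pi"
      using n by (simp add: field_simps)
    moreover have "cis (s * pi) = - 1"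
      using s by (auto simp: complex_eq_iff)
    ultimately show ?thesis
      by (simp add: quad_phase_def cis_mult[symmetric])
  qed
  \<comment> \<open>The choice of square root decides \<open>d\<close>, since \<open>d = 1\<close>
    negates the value at 1.\<close>
  ultimately obtain d where d: "d \<in> {0, 1}" and a1: "a 1 = quad_phase n d s 1"
    by (metis insertCI)
  \<comment> \<open>For second index 1 the equation is a second-order recurrence, so two consecutive
    values are carried along.\<close>
  have step: "a (int j) = quad_phase n d s (int j) \<and> a (int (Suc j)) = quad_phase n d s (int (Suc j))" for j
  proof (induction j)
    case (Suc j)
    have "a (int (Suc j) + 1) + a (int j) = quad_phase n d s (int (Suc j) + 1) + quad_phase n d s (int j)"
      using eq[of "int (Suc j)" 1] quad_phase_functional_equation[OF n s, of d "int (Suc j)" 1] Suc a1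
      by simp
    then show ?case using Suc by (simp add: add.commute)
  qed (simp add: a0 a1)
  \<comment> \<open>The value at \<open>n\<close> is a sign; its being 1 excludes
    \<open>d = 0\<close> for odd \<open>n\<close>.\<close>
  have "quad_phase n d s (int n) = cis (s * pi) ^ (n * (d + 1))"
    unfolding quad_phase_def DeMoivre
    by (rule arg_cong[where f = cis]) (use n in \<open>simp add: field_simps power2_eq_square\<close>)
  also have "cis (s * pi) = - 1"
    using s by (auto simp: complex_eq_iff)
  finally have "(- 1 :: complex) ^ (n * (d + 1)) = 1"
    using step[of n] an by simp
  then have "even (n * (d + 1))"
    by (metis minus_one_power_iff one_neq_neg_one)
  then show ?thesis
    using that[OF s d] step by blast
qed

text \<open>The product of cosines leads to Fourier coefficients at \<open>i + j\<close> and
  \<open>i - j\<close>. By the functional equation of the inverse phase these recombine to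
  \<open>ngon_cos n (i * j)\<close>, so both sides differ only by a constant factor.\<close>

lemma cube_equation_quad_phase:
  assumes n: "n > 0" and s: "s \<in> {1, -1}" and ev: "even (n * (d + 1))"
  shows "cube_equation n (\<lambda>x. c * quad_phase n d s x) \<longleftrightarrow> of_nat n * c ^ 3 * gauss_sum n d s = 1"
proof -
  let ?Q = "quad_phase n d s" and ?C = "ngon_cos n"
  define G where "G = gauss_sum n d s"
  \<comment> \<open>The cosine transform averages the Fourier coefficients at \<open>y\<close> and
    \<open>- y\<close>, which agree because the phase is even.\<close>
  have four: "(\<Sum>x<n. ?C (y * int x) * ?Q (int x)) = G / ?Q y" for y
  proof -
    have "2 * (\<Sum>x<n. ?C (y * int x) * ?Q (int x))
        = (\<Sum>x<n. (2 * ?C (y * int x)) * ?Q (int x))"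
      by (simp add: sum_distrib_left mult_ac)
    also have "\<dots> = (\<Sum>x<n. cis (s * (2 * pi * (real x * real_of_int y) / n)) * ?Q (int x))
        + (\<Sum>x<n. cis (s * (2 * pi * (real x * real_of_int (- y)) / n)) * ?Q (int x))"
      unfolding ngon_cos_cis[OF s] by (simp add: sum.distrib[symmetric] algebra_simps)
    also have "\<dots> = 2 * (G / ?Q y)"
      unfolding quad_phase_fourier[OF n s ev] quad_phase_minus[OF n s] G_def by simp
    finally show ?thesis
      unfolding mult_cancel_left by (metis zero_neq_numeral)
  qed
  have "of_nat n * (c * ?Q i) * (c * ?Q j) *
      (\<Sum>x<n. ?C (i * int x) * ?C (int x * j) * (c * ?Q (int x)))
      = (of_nat n * c ^ 3 * G) * ?C (i * j)" for i j
  proof -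
    have *: "?C (i * int x) * ?C (int x * j) * (c * ?Q (int x))
        = c / 2 * (?C ((i + j) * int x) * ?Q (int x) + ?C ((i - j) * int x) * ?Q (int x))" for x
      using arg_cong[OF ngon_cos_mult[of n "i * int x" "int x * j"], of "\<lambda>z. c / 2 * (z * ?Q (int x))"]
      by (simp add: algebra_simps add_divide_distrib)
    have fourier: "(\<Sum>x<n. ?C (i * int x) * ?C (int x * j) * (c * ?Q (int x)))
        = c / 2 * (G / ?Q (i + j) + G / ?Q (i - j))"
      by (simp only: * four sum_distrib_left[symmetric] sum.distrib)
    have inv_sum: "?Q i * ?Q j * (1 / ?Q (i + j) + 1 / ?Q (i - j)) = 2 * ?C (i * j)"
    proof -
      \<comment> \<open>Inverting the phase flips the sign \<open>s\<close>, so the functional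
        equation applies to the inverses too.\<close>
      have "1 / ?Q x = quad_phase n d (- s) x" for x
        by (simp add: quad_phase_def cis_divide[of 0, simplified])
      then have sum: "1 / ?Q (i + j) + 1 / ?Q (i - j)
          = 2 * ?C (i * j) * quad_phase n d (- s) i * quad_phase n d (- s) j"
        using quad_phase_functional_equation[OF n, of "- s" d i j] s by auto
      have inv: "?Q x * quad_phase n d (- s) x = 1" for x
        by (simp add: quad_phase_def cis_mult)
      have "?Q i * ?Q j * (1 / ?Q (i + j) + 1 / ?Q (i - j))
          = 2 * ?C (i * j) * (?Q i * quad_phase n d (- s) i) * (?Q j * quad_phase n d (- s) j)"
        unfolding sum by (simp only: mult_ac)
      then show ?thesis
        by (simp only: inv mult_1_right)
    qed
    have "of_nat n * (c * ?Q i) * (c * ?Q j) *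
        (\<Sum>x<n. ?C (i * int x) * ?C (int x * j) * (c * ?Q (int x)))
        = of_nat n * (c * ?Q i) * (c * ?Q j) * (c / 2 * (G / ?Q (i + j) + G / ?Q (i - j)))"
      unfolding fourier ..
    also have "\<dots> = of_nat n * c ^ 3 * G / 2 * (?Q i * ?Q j * (1 / ?Q (i + j) + 1 / ?Q (i - j)))"
    proof -
      have "N * (c * a) * (c * b) * (c / 2 * (G * w)) = N * c ^ 3 * G / 2 * (a * b * w)" for N a b w :: complex
        by (simp add: power3_eq_cube)
      moreover have "G / ?Q (i + j) + G / ?Q (i - j) = G * (1 / ?Q (i + j) + 1 / ?Q (i - j))"
        by (simp add: distrib_left)
      ultimately show ?thesis by metis
    qed
    also have "\<dots> = of_nat n * c ^ 3 * G * ?C (i * j)"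
      unfolding inv_sum by simp
    finally show ?thesis .
  qed
  then have "cube_equation n (\<lambda>x. c * ?Q x) \<longleftrightarrow> (\<forall>i j. (of_nat n * c ^ 3 * G) * ?C (i * j) = ?C (i * j))"
    unfolding cube_equation_def by (simp only:)
  also have "\<dots> \<longleftrightarrow> of_nat n * c ^ 3 * G = 1"
  proof
    assume "\<forall>i j. (of_nat n * c ^ 3 * G) * ?C (i * j) = ?C (i * j)"
    from this[rule_format, of 0 0] show "of_nat n * c ^ 3 * G = 1" by simp
  qed simp
  finally show ?thesis by (simp add: G_def)
qed

lemma cube_equation_imp_quad_phase:
  assumes n5: "n \<ge> 5" and per: "\<And>x. \<tau> (x + int n) = \<tau> x" and cube: "cube_equation n \<tau>"
  obtains s d where "s \<in> {1, -1}" "d \<in> {0, 1}" "even (n * (d + 1))"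
    "\<And>j. \<tau> (int j) = \<tau> 0 * quad_phase n d s (int j)"
proof -
  let ?C = "ngon_cos n"
  have n: "n > 0" using n5 by simp
  \<comment> \<open>\<open>g\<close> is the cosine transform of \<tau>. The case
    \<open>j = 0\<close> of \<open>E\<close> shows that it is proportional to
    \<open>1 / \<tau>\<close>, and that \<tau> has no zeros; inserting this into \<open>E\<close>
    eliminates \<open>g\<close>.\<close>
  define g where "g = (\<lambda>y. \<Sum>x<n. ?C (y * int x) * \<tau> (int x))"
  have E: "of_nat n * \<tau> i * \<tau> j * (g (i + j) + g (i - j)) = 2 * ?C (i * j)" for i j
  proof -
    have "?C ((i + j) * int x) * \<tau> (int x) + ?C ((i - j) * int x) * \<tau> (int x)
        = 2 * (?C (i * int x) * ?C (int x * j) * \<tau> (int x))" for x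
      using arg_cong[OF ngon_cos_mult[of n "i * int x" "int x * j"], of "\<lambda>z. z * \<tau> (int x)"]
      by (simp add: algebra_simps)
    then have "g (i + j) + g (i - j) = 2 * (\<Sum>x<n. ?C (i * int x) * ?C (int x * j) * \<tau> (int x))"
      unfolding g_def by (simp add: sum.distrib[symmetric] sum_distrib_left)
    then have "of_nat n * \<tau> i * \<tau> j * (g (i + j) + g (i - j)) = 2 * (of_nat n * \<tau> i * \<tau> j *
        (\<Sum>x<n. ?C (i * int x) * ?C (int x * j) * \<tau> (int x)))"
      by (simp only: mult.left_commute)
    also have "\<dots> = 2 * ?C (i * j)"
      by (simp only: cube[unfolded cube_equation_def, rule_format])
    finally show ?thesis .
  qed
  have g: "of_nat n * \<tau> i * \<tau> 0 * g i = 1" for i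
    using E[of i 0] by (simp add: mult.assoc)
  have nz: "\<tau> i \<noteq> 0" for i
    using g[of i] by auto
  define a where "a = (\<lambda>i. \<tau> 0 / \<tau> i)"
  have ga: "g i = a i / (of_nat n * \<tau> 0 ^ 2)" for i
    using g[of i] nz n unfolding a_def by (simp add: field_simps power2_eq_square)
  have eq: "a (i + j) + a (i - j) = 2 * ?C (i * j) * a i * a j" for i j
  proof -
    have "2 * ?C (i * j) * a i * a j = of_nat n * \<tau> i * \<tau> j * (g (i + j) + g (i - j)) * a i * a j"
      unfolding E ..
    also have "\<dots> = of_nat n * \<tau> 0 ^ 2 * (g (i + j) + g (i - j))"
      using nz by (simp add: a_def power2_eq_square)
    also have "\<dots> = a (i + j) + a (i - j)"
      unfolding ga using nz n by (simp add: add_divide_distrib[symmetric])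
    finally show ?thesis ..
  qed
  have "a (int n) = 1"
    using per[of 0] nz by (simp add: a_def)
  then obtain s d where sd: "s \<in> {1, -1}" "d \<in> {0, 1}" "even (n * (d + 1))"
    and aQ: "\<And>j. a (int j) = quad_phase n d s (int j)"
    using cos_functional_equation[OF n5 _ _ eq] nz by (metis a_def divide_self)
  \<comment> \<open>\<open>a\<close> is the inverse of the normalised \<tau>, hence the sign changes
    to \<open>- s\<close>.\<close>
  have "\<tau> (int j) = \<tau> 0 * quad_phase n d (- s) (int j)" for j
  proof -
    have "\<tau> 0 / \<tau> (int j) * quad_phase n d (- s) (int j) = 1"
      using aQ[of j] by (simp add: a_def quad_phase_def cis_mult)
    then show ?thesis using nz[of "int j"] by (simp add: field_simps)
  qed
  then show ?thesis
    using that[of "- s" d] sd by auto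
qed

section \<open>The solutions\<close>

lemma ngon_cube_iff_quad_phase:
  assumes n5: "n \<ge> 5" and T: "T \<in> carrier_mat (n div 2 + 1) (n div 2 + 1)" "diagonal_mat T"
  shows "(ngon_eigenmatrix n * T) ^\<^sub>m 3 = 1\<^sub>m (n div 2 + 1) \<longleftrightarrow>
    (\<exists>s\<in>{1, -1}. \<exists>d\<in>{0, 1}. even (n * (d + 1)) \<and> (\<exists>c.
      (\<forall>j\<le>n div 2. T $$ (j, j) = c * quad_phase n d s (int j)) \<and>
      of_nat n * c ^ 3 * gauss_sum n d s = 1))" (is "?l \<longleftrightarrow> ?r")
proof
  have n: "n > 0" using n5 by simp
  {
    assume ?l
    \<comment> \<open>\<open>fold x\<close> is the distance from \<open>x\<close> to the nearest
      multiple of \<open>n\<close>, that is, the class containing the difference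
      \<open>x\<close>.\<close>
    define fold where "fold = (\<lambda>x. let r = nat (x mod int n) in min r (n - r))"
    define \<tau> where "\<tau> = (\<lambda>x. T $$ (fold x, fold x))"
    have per: "\<tau> (x + int n) = \<tau> x" for x
      by (simp add: \<tau>_def fold_def)
    have ev: "\<tau> (- x) = \<tau> x" for x
    proof (cases "x mod int n = 0")
      case True
      then show ?thesis by (simp add: \<tau>_def fold_def zmod_zminus1_eq_if)
    next
      case False
      have "0 \<le> x mod int n" "x mod int n < int n" using n by simp_all
      with False have "fold (- x) = fold x"
        by (simp add: fold_def Let_def zmod_zminus1_eq_if nat_diff_distrib min.commute)
      then show ?thesis by (simp add: \<tau>_def)
    qed
    have Tt: "T $$ (j, j) = \<tau> (int j)" if "j \<le> n div 2" for j
    proof -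
      have "int j mod int n = int j" using that n by simp
      moreover have "j \<le> n - j" using that by linarith
      ultimately have "fold (int j) = j" by (simp add: fold_def)
      then show ?thesis by (simp add: \<tau>_def)
    qed
    have "cube_equation n \<tau>"
      using \<open>?l\<close> ngon_cube_iff_equation[where \<tau> = \<tau>, OF n T per ev Tt] by blast
    then obtain s d where sd: "s \<in> {1, -1}" "d \<in> {0, 1}" "even (n * (d + 1))"
      and Q: "\<And>j. \<tau> (int j) = \<tau> 0 * quad_phase n d s (int j)"
      using cube_equation_imp_quad_phase[where \<tau> = \<tau>, OF n5 per] by blast
    have TQ: "T $$ (j, j) = \<tau> 0 * quad_phase n d s (int j)" if "j \<le> n div 2" for j
      using Tt[OF that] Q by simp
    \<comment> \<open>The phase is another even periodic extension of the diagonal, so it satisfies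
      the equation as well, and this fixes the constant.\<close>
    have "cube_equation n (\<lambda>x. \<tau> 0 * quad_phase n d s x)"
      using \<open>?l\<close> ngon_cube_iff_equation[where \<tau> = "\<lambda>x. \<tau> 0 * quad_phase n d s x", OF n T _ _ TQ]
        quad_phase_period[OF n sd(1,3)] quad_phase_minus[OF n sd(1)] by simp
    then show ?r
      using sd TQ cube_equation_quad_phase[OF n sd(1,3)] by blast
  }
  assume ?r
  then obtain s d c where sd: "s \<in> {1, -1}" "d \<in> {0, 1}" "even (n * (d + 1))"
    and TQ: "\<And>j. j \<le> n div 2 \<Longrightarrow> T $$ (j, j) = c * quad_phase n d s (int j)"
    and "of_nat n * c ^ 3 * gauss_sum n d s = 1"
    by blast
  then have "cube_equation n (\<lambda>x. c * quad_phase n d s x)"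
    using cube_equation_quad_phase[OF n sd(1,3)] by blast
  then show ?l
    using ngon_cube_iff_equation[where \<tau> = "\<lambda>x. c * quad_phase n d s x", OF n T _ _ TQ]
      quad_phase_period[OF n sd(1,3)] quad_phase_minus[OF n sd(1)] by simp
qed

lemma powr_three_halves: "0 \<le> x \<Longrightarrow> x powr (3 / 2) = x * sqrt x" for x :: real
  using powr_add[of x 1 "1 / 2"] by (cases "x = 0") (simp_all add: powr_half_sqrt)

lemma quad_phase_exp:
  assumes "n > 0"
  shows "quad_phase n 0 s (int j) = exp (of_real s * of_real pi * \<i> * of_nat j ^ 2 / of_nat n)"
    and "s \<in> {1, -1} \<Longrightarrow>
      quad_phase n 1 s (int j) = (-1) ^ j * exp (of_real s * of_real pi * \<i> * of_nat j ^ 2 / of_nat n)"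
proof -
  show 0: "quad_phase n 0 s (int j) = exp (of_real s * of_real pi * \<i> * of_nat j ^ 2 / of_nat n)"
    by (simp add: quad_phase_def cis_conv_exp mult_ac)
  assume s: "s \<in> {1, -1}"
  have "s * pi * (real_of_int (int j) ^ 2 + real 1 * n * real_of_int (int j)) / n
      = real j * (s * pi) + s * pi * (real_of_int (int j) ^ 2 + real 0 * n * real_of_int (int j)) / n"
    using assms by (simp add: field_simps)
  then have "quad_phase n 1 s (int j) = cis (s * pi) ^ j * quad_phase n 0 s (int j)"
    by (simp only: quad_phase_def DeMoivre cis_mult)
  also have "cis (s * pi) = - 1"
    using s by (auto simp: complex_eq_iff)
  finally show "quad_phase n 1 s (int j) = (-1) ^ j * exp (of_real s * of_real pi * \<i> * of_nat j ^ 2 / of_nat n)"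
    by (simp add: 0)
qed

text \<open>The modulus \<open>sqrt n\<close> joins the factor \<open>n\<close> to form
  \<open>n powr (3 / 2)\<close>; the phase moves to the other side and is conjugated.\<close>

lemma gauss_sum_condition:
  fixes x :: real and c :: complex
  assumes "n > 0" "G = of_real (sqrt n) * cis x"
  shows "of_nat n * c ^ 3 * G = 1 \<longleftrightarrow> c ^ 3 * of_real (real n powr (3 / 2)) = cis (- x)"
proof -
  have "of_nat n * c ^ 3 * G = (c ^ 3 * of_real (real n powr (3 / 2))) * cis x"
    by (simp add: assms(2) powr_three_halves mult_ac)
  moreover have "cis (- x) * cis x = 1"
    by (simp add: cis_mult)
  ultimately show ?thesis
    by (metis cis_neq_zero mult_right_cancel)
qed

lemma alternating_condition:
  assumes n: "n > 0" and s: "s \<in> {1, -1}"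
  shows "of_nat n * c ^ 3 * gauss_sum n 1 s = 1 \<longleftrightarrow>
    c ^ 3 * of_real (real n powr (3 / 2)) * (-1) ^ (n div 4) =
         (if n mod 4 = 0 then exp (- of_real s * of_real pi * \<i> / 4)
          else if n mod 4 = 2 then exp (of_real s * of_real pi * \<i> / 4)
          else if n mod 4 = 1 then 1
          else of_real s * \<i>)" (is "_ \<longleftrightarrow> _ = ?R")
proof -
  define m r where "m = n div 4" and "r = n mod 4"
  have nmr: "real n = 4 * real m + real r"
    unfolding m_def r_def by (metis mult_div_mod_eq of_nat_add of_nat_mult of_nat_numeral)
  \<comment> \<open>Writing \<open>n = 4 * m + r\<close> splits off the sign \<open>(-1)^m\<close>;
    the rest of the phase depends only on \<open>r\<close>.\<close>
  have "- (s * pi * (1 - real n) / 4) = real m * (s * pi) + s * pi * (real r - 1) / 4"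
    by (simp add: nmr field_simps)
  then have "cis (- (s * pi * (1 - real n) / 4)) = cis (s * pi) ^ m * cis (s * pi * (real r - 1) / 4)"
    by (simp only: DeMoivre cis_mult)
  also have "cis (s * pi) = - 1"
    using s by (auto simp: complex_eq_iff)
  also have "cis (s * pi * (real r - 1) / 4) = ?R"
  proof -
    have e: "cis (t * pi / 4) = exp (of_real t * of_real pi * \<i> / 4)" for t
      by (simp add: cis_conv_exp mult_ac)
    have "r < 4" by (simp add: r_def)
    then consider "r = 0" | "r = 1" | "r = 2" | "r = 3" by linarith
    then show ?thesis
    proof cases
      case 1
      then show ?thesis using e[of "- s"] by (simp add: r_def[symmetric])
    next
      case 3
      then show ?thesis using e[of s] by (simp add: r_def[symmetric])
    next
      case 4
      then have "s * pi * (real r - 1) / 4 = s * (pi / 2)" by simp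
      then show ?thesis using s 4 by (auto simp: r_def[symmetric])
    qed (simp add: r_def[symmetric])
  qed
  finally have "of_nat n * c ^ 3 * gauss_sum n 1 s = 1 \<longleftrightarrow>
      c ^ 3 * of_real (real n powr (3 / 2)) = (-1) ^ m * ?R"
    using gauss_sum_condition[OF n gauss_sum_alternating[OF n s], of c] by simp
  also have "\<dots> \<longleftrightarrow> c ^ 3 * of_real (real n powr (3 / 2)) * (-1) ^ m = ?R"
  proof -
    have sq: "(-1 :: complex) ^ m * (-1) ^ m = 1"
      by (simp flip: power_mult_distrib)
    have "x = (-1) ^ m * y \<longleftrightarrow> x * (-1) ^ m = y" for x y :: complex
      using sq by (metis mult.assoc mult.commute mult_1_left)
    then show ?thesis by blast
  qed
  finally show ?thesis by (simp add: m_def)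
qed

lemma even_condition:
  assumes n: "n > 0" "even n" and s: "s \<in> {1, -1}"
  shows "of_nat n * c ^ 3 * gauss_sum n 0 s = 1 \<longleftrightarrow>
    c ^ 3 * of_real (real n powr (3 / 2)) = exp (- of_real s * of_real pi * \<i> / 4)"
  unfolding gauss_sum_condition[OF n(1) gauss_sum_even[OF n s]] by (simp add: cis_conv_exp mult_ac)

text \<open>The first family is \<open>d = 1\<close>, the second \<open>d = 0\<close>. The phase of
  \<open>c ^ 3\<close> is conjugate to that of the Gauss sum, so outside \<open>n mod 4 = 1\<close>
  its sign is opposite to the one in the informal statement, in accordance with
  \<open>hexagon_phase\<close>.\<close>

theorem theorem6:
  fixes n :: nat and T :: "complex mat"
  assumes "n \<ge> 6"
    and "T \<in> carrier_mat (n div 2 + 1) (n div 2 + 1)"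
    and "diagonal_mat T"
  shows "(ngon_eigenmatrix n * T) ^\<^sub>m 3 = 1\<^sub>m (n div 2 + 1) \<longleftrightarrow>
    (\<exists>s \<in> {1, -1 :: complex}. \<exists>c :: complex.
       (\<forall>j \<le> n div 2.
          T $$ (j, j) = c * (-1) ^ j * exp (s * of_real pi * \<i> * of_nat j ^ 2 / of_nat n)) \<and>
       c ^ 3 * of_real (real n powr (3 / 2)) * (-1) ^ (n div 4) =
         (if n mod 4 = 0 then exp (- s * of_real pi * \<i> / 4)
          else if n mod 4 = 2 then exp (s * of_real pi * \<i> / 4)
          else if n mod 4 = 1 then 1
          else s * \<i>)) \<or>
    (even n \<and> (\<exists>s \<in> {1, -1 :: complex}. \<exists>c :: complex.
       (\<forall>j \<le> n div 2.
          T $$ (j, j) = c * exp (s * of_real pi * \<i> * of_nat j ^ 2 / of_nat n)) \<and>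
       c ^ 3 * of_real (real n powr (3 / 2)) = exp (- s * of_real pi * \<i> / 4)))"
proof -
  have n: "n > 0" using assms(1) by simp
  define A where "A = (\<lambda>s::complex. \<exists>c :: complex.
       (\<forall>j \<le> n div 2.
          T $$ (j, j) = c * (-1) ^ j * exp (s * of_real pi * \<i> * of_nat j ^ 2 / of_nat n)) \<and>
       c ^ 3 * of_real (real n powr (3 / 2)) * (-1) ^ (n div 4) =
         (if n mod 4 = 0 then exp (- s * of_real pi * \<i> / 4)
          else if n mod 4 = 2 then exp (s * of_real pi * \<i> / 4)
          else if n mod 4 = 1 then 1
          else s * \<i>))"
  define B where "B = (\<lambda>s::complex. \<exists>c :: complex.
       (\<forall>j \<le> n div 2.
          T $$ (j, j) = c * exp (s * of_real pi * \<i> * of_nat j ^ 2 / of_nat n)) \<and>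
       c ^ 3 * of_real (real n powr (3 / 2)) = exp (- s * of_real pi * \<i> / 4))"
  define Q where "Q = (\<lambda>s d. \<exists>c. (\<forall>j\<le>n div 2. T $$ (j, j) = c * quad_phase n d s (int j)) \<and>
      of_nat n * c ^ 3 * gauss_sum n d s = 1)"
  have QA: "Q s 1 \<longleftrightarrow> A (of_real s)" if "s \<in> {1, -1}" for s
    unfolding Q_def A_def alternating_condition[OF n that] quad_phase_exp(2)[OF n that]
      mult.assoc[symmetric] ..
  have QB: "Q s 0 \<longleftrightarrow> B (of_real s)" if "s \<in> {1, -1}" "even n" for s
    unfolding Q_def B_def even_condition[OF n that(2,1)] quad_phase_exp(1)[OF n] ..
  have "(ngon_eigenmatrix n * T) ^\<^sub>m 3 = 1\<^sub>m (n div 2 + 1) \<longleftrightarrow>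
      (\<exists>s\<in>{1, -1}. \<exists>d\<in>{0, 1}. even (n * (d + 1)) \<and> Q s d)"
    unfolding Q_def by (rule ngon_cube_iff_quad_phase) (use assms in simp_all)
  \<comment> \<open>For \<open>d = 1\<close> the parity condition always holds; for
    \<open>d = 0\<close> it says that \<open>n\<close> is even.\<close>
  also have "\<dots> \<longleftrightarrow> (\<exists>s\<in>{1, -1}. Q s 1) \<or> (even n \<and> (\<exists>s\<in>{1, -1}. Q s 0))"
    by auto
  also have "\<dots> \<longleftrightarrow> (\<exists>s\<in>{1, -1}. A s) \<or> (even n \<and> (\<exists>s\<in>{1, -1}. B s))"
    using QA[of 1] QA[of "-1"] QB[of 1] QB[of "-1"] by auto
  finally show ?thesis
    unfolding A_def B_def .
qed

end
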